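(* Let $(M,E^* )$ be a constrained matrix, where $M$ is an $n\times m$ binary matrix whose conflict graph has no edges and $E^*$ is a set of $0$-entries of $M$. Then there is an algorithm running in time polynomial in the size of $M$ that constructs a persistent perfect phylogeny for $M$ consistent with $E^*$ whenever one exists (and reports that none exists otherwise). Moreover, if $E^*=\emptyset$, then $M$ admits a persistent perfect phylogeny.
   Context: Rows of $M$ are species $s_1,\dots,s_n$, columns are characters $c_1,\dots,c_m$; $M[i,j]=1$ means $s_i$ has $c_j$. $E^*$ is a set of pairs $(i,j)$ with $M[i,j]=0$. Two characters $c_1,c_2$ are conflicting if the set of pairs $(M[s,c_1],M[s,c_2])$ over all species equals $\{(0,0),(0,1),(1,0),(1,1)\}$; the conflict graph has the characters as vertices and an edge between each pair of conflicting characters. Persistent perfect phylogeny (p-pp) for $M$: a rooted tree $T$ such that (1) each node $x$ is labeled by a vector $l_x\in\{0,1\}^m$; (2) the root is labeled by the all-zero vector; (3) each edge is labeled by at least one character; (4) for each character $c_j$ there are at most two edges $e=(x,y)$, $e'=(u,v)$ (parent first) with $l_x[j]\neq l_y[j]$, $l_u[j]\neq l_v[j]$; if there are two, they lie on a common root-to-leaf path, and if $e$ is closer to the root then $l_x[j]=l_v[j]=0$, $l_y[j]=l_u[j]=1$ ($e$ labeled $c_j^+$, $e'$ labeled $c_j^-$); (5) each row $r$ of $M$ labels exactly one node $x$ of $T$, and $l_x=r$. A p-pp $T$ is consistent with $E^*$ if for every $(i,j)\in E^*$, no edge on the path from the root to the node labeled by row $s_i$ changes the state of $c_j$ (i.e.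 $c_j$ is not persistent — gained and then lost — in $s_i$). *)

theory Defs
  imports
    "Jordan_Normal_Form.Matrix"
    "HOL-Library.Z2"
    "HOL-Computational_Algebra.Polynomial"
begin

section \<open>Binary matrices, conflicts and constraints\<close>

text \<open>Rows are species and columns are characters, both numbered from 0.\<close>

definition conflicting :: "bit mat \<Rightarrow> nat \<Rightarrow> nat \<Rightarrow> bool" where
  "conflicting M c d \<longleftrightarrow>
     {(M $$ (s, c), M $$ (s, d)) | s. s < dim_row M} = {(0, 0), (0, 1), (1, 0), (1, 1)}"

definition conflict_edges :: "bit mat \<Rightarrow> nat set set" where
  "conflict_edges M = {{c, d} | c d. c < dim_col M \<and> d < dim_col M \<and> conflicting M c d}"

definition constrained_matrix :: "bit mat \<Rightarrow> (nat \<times> nat) set \<Rightarrow> bool" where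
  "constrained_matrix M Es \<longleftrightarrow>
     Es \<subseteq> {(i, j). i < dim_row M \<and> j < dim_col M \<and> M $$ (i, j) = 0}"

text \<open>
  The number of entries plus the two dimensions. The dimensions only matter for matrices without
  entries; otherwise the value lies between \<open>n * m\<close> and \<open>3 * n * m\<close>.
\<close>

definition mat_size :: "'a mat \<Rightarrow> nat" where
  "mat_size M = dim_row M * dim_col M + dim_row M + dim_col M"


section \<open>Persistent perfect phylogenies\<close>

text \<open>
  Arcs are directed away from the root. \<open>state T x\<close> is the vector labelling node \<open>x\<close>,
  and \<open>place T i\<close> is the node labelled by row \<open>i\<close>; being a function, it assigns exactly one node
  to each row.
\<close>

record 'v phylogeny =
  nodes :: "'v set"
  arcs :: "('v \<times> 'v) set"
  root :: 'v
  state :: "'v \<Rightarrow> bit vec"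
  place :: "nat \<Rightarrow> 'v"

definition rooted_tree :: "'v set \<Rightarrow> ('v \<times> 'v) set \<Rightarrow> 'v \<Rightarrow> bool" where
  "rooted_tree V E r \<longleftrightarrow>
     finite V \<and> r \<in> V \<and> E \<subseteq> V \<times> V \<and>
     (\<forall>x. (x, r) \<notin> E) \<and>
     (\<forall>y \<in> V - {r}. \<exists>!x. (x, y) \<in> E) \<and>
     (\<forall>y \<in> V. (r, y) \<in> E\<^sup>*)"

definition leaf :: "('v, 'b) phylogeny_scheme \<Rightarrow> 'v \<Rightarrow> bool" where
  "leaf T z \<longleftrightarrow> z \<in> nodes T \<and> (\<forall>y. (z, y) \<notin> arcs T)"

text \<open>The arcs on the path from the root to \<open>z\<close>.\<close>

definition root_path :: "('v, 'b) phylogeny_scheme \<Rightarrow> 'v \<Rightarrow> ('v \<times> 'v) set" where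
  "root_path T z = {(x, y) \<in> arcs T. (y, z) \<in> (arcs T)\<^sup>*}"

definition change_arcs :: "('v, 'b) phylogeny_scheme \<Rightarrow> nat \<Rightarrow> ('v \<times> 'v) set" where
  "change_arcs T j = {(x, y) \<in> arcs T. state T x $ j \<noteq> state T y $ j}"

datatype signed_char = Gain nat | Loss nat

definition arc_label :: "nat \<Rightarrow> ('v, 'b) phylogeny_scheme \<Rightarrow> 'v \<times> 'v \<Rightarrow> signed_char set" where
  "arc_label m T = (\<lambda>(x, y).
     {Gain j | j. j < m \<and> state T x $ j = 0 \<and> state T y $ j = 1} \<union>
     {Loss j | j. j < m \<and> state T x $ j = 1 \<and> state T y $ j = 0})"

definition persistent_perfect_phylogeny ::
    "bit mat \<Rightarrow> ('v, 'b) phylogeny_scheme \<Rightarrow> bool" where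
  "persistent_perfect_phylogeny M T \<longleftrightarrow>
     rooted_tree (nodes T) (arcs T) (root T) \<and>
     (\<forall>x \<in> nodes T. state T x \<in> carrier_vec (dim_col M)) \<and>
     state T (root T) = 0\<^sub>v (dim_col M) \<and>
     (\<forall>e \<in> arcs T. arc_label (dim_col M) T e \<noteq> {}) \<and>
     (\<forall>j < dim_col M.
        card (change_arcs T j) \<le> 2 \<and>
        (\<forall>x y u v. (x, y) \<in> change_arcs T j \<and> (u, v) \<in> change_arcs T j \<and> (x, y) \<noteq> (u, v) \<longrightarrow>
           (\<exists>z. leaf T z \<and> (x, y) \<in> root_path T z \<and> (u, v) \<in> root_path T z) \<and>
           ((y, u) \<in> (arcs T)\<^sup>* \<longrightarrow>
              state T x $ j = 0 \<and> state T v $ j = 0 \<and> state T y $ j = 1 \<and> state T u $ j = 1))) \<and>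
     (\<forall>i < dim_row M. place T i \<in> nodes T \<and> state T (place T i) = row M i)"

definition consistent_with :: "('v, 'b) phylogeny_scheme \<Rightarrow> (nat \<times> nat) set \<Rightarrow> bool" where
  "consistent_with T Es \<longleftrightarrow>
     (\<forall>(i, j) \<in> Es. root_path T (place T i) \<inter> change_arcs T j = {})"


section \<open>A machine model\<close>

text \<open>
  A first-order functional language over binary trees, in the style of pure Lisp. A program is a
  list of mutually recursive unary functions, given by their bodies; the first one is the main
  function. Every evaluation step has unit cost. As values can be shared, each step takes constant
  time on a pointer machine, so polynomial time here is polynomial time on a Turing machine,
  provided that the result is not exponentially larger than its shared representation.
  Therefore writing the result out in full is charged to the running time as well.
\<close>

datatype dat = Atom | Dot dat dat

fun head :: "dat \<Rightarrow> dat" where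
  "head Atom = Atom"
| "head (Dot a b) = a"

fun tail :: "dat \<Rightarrow> dat" where
  "tail Atom = Atom"
| "tail (Dot a b) = b"

datatype expr =
    EParam
  | EAtom
  | EDot expr expr
  | EHead expr
  | ETail expr
  | EIf expr expr expr
  | ECall nat expr

type_synonym program = "expr list"

text \<open>
  \<open>eval P e x v t\<close>: with the current function parameter bound to \<open>x\<close>, the expression \<open>e\<close>
  evaluates to \<open>v\<close> in \<open>t\<close> steps.
\<close>

inductive eval :: "program \<Rightarrow> expr \<Rightarrow> dat \<Rightarrow> dat \<Rightarrow> nat \<Rightarrow> bool" for P where
  eval_param: "eval P EParam x x 1"
| eval_atom: "eval P EAtom x Atom 1"
| eval_dot: "eval P (EDot e f) x (Dot a b) (s + t + 1)"
    if "eval P e x a s" and "eval P f x b t"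
| eval_head: "eval P (EHead e) x (head a) (s + 1)"
    if "eval P e x a s"
| eval_tail: "eval P (ETail e) x (tail a) (s + 1)"
    if "eval P e x a s"
| eval_if_true: "eval P (EIf c e f) x a (s + t + 1)"
    if "eval P c x b s" and "b \<noteq> Atom" and "eval P e x a t"
| eval_if_false: "eval P (EIf c e f) x a (s + t + 1)"
    if "eval P c x Atom s" and "eval P f x a t"
| eval_call: "eval P (ECall k e) x b (s + t + 1)"
    if "eval P e x a s" and "k < length P" and "eval P (P ! k) a b t"

lemma eval_deterministic:
  assumes "eval P e x v t" and "eval P e x v' t'"
  shows "v' = v \<and> t' = t"
  using assms
proof (induction arbitrary: v' t' rule: eval.induct)
  case eval_param
  then show ?case by (auto elim: eval.cases)
next
  case eval_atom
  then show ?case by (auto elim: eval.cases)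
next
  case (eval_dot e x a s f b t)
  from eval_dot.prems eval_dot.IH show ?case by cases blast+
next
  case (eval_head e x a s)
  from eval_head.prems eval_head.IH show ?case by cases blast+
next
  case (eval_tail e x a s)
  from eval_tail.prems eval_tail.IH show ?case by cases blast+
next
  case (eval_if_true c x b s e a t f)
  from eval_if_true.prems eval_if_true.IH eval_if_true.hyps show ?case by cases blast+
next
  case (eval_if_false c x s f a t e)
  from eval_if_false.prems eval_if_false.IH show ?case by cases blast+
next
  case (eval_call e x a s k b t)
  from eval_call.prems eval_call.IH show ?case by cases blast+
qed

definition computes_in_time :: "program \<Rightarrow> dat \<Rightarrow> dat \<Rightarrow> nat \<Rightarrow> bool" where
  "computes_in_time P x y t \<longleftrightarrow> P \<noteq> [] \<and> (\<exists>s. eval P (P ! 0) x y s \<and> t = s + size y)"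


section \<open>Encoding of inputs and outputs\<close>

fun enc_list :: "('a \<Rightarrow> dat) \<Rightarrow> 'a list \<Rightarrow> dat" where
  "enc_list f [] = Atom"
| "enc_list f (a # as) = Dot (f a) (enc_list f as)"

fun enc_nat :: "nat \<Rightarrow> dat" where
  "enc_nat 0 = Atom"
| "enc_nat (Suc k) = Dot Atom (enc_nat k)"

definition enc_bit :: "bit \<Rightarrow> dat" where
  "enc_bit b = (if b = 0 then Atom else Dot Atom Atom)"

definition enc_vec :: "bit vec \<Rightarrow> dat" where
  "enc_vec v = enc_list enc_bit (list_of_vec v)"

definition enc_mat :: "bit mat \<Rightarrow> dat" where
  "enc_mat M = enc_list enc_vec (rows M)"

text \<open>
  The constraints are given as a 0/1 matrix of the same shape as \<open>M\<close>. The dimensions, in unary,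
  are part of the input because the rows do not determine \<open>m\<close> if \<open>n = 0\<close>.
\<close>

definition enc_instance :: "bit mat \<Rightarrow> (nat \<times> nat) set \<Rightarrow> dat" where
  "enc_instance M Es =
     Dot (enc_nat (dim_row M)) (Dot (enc_nat (dim_col M)) (Dot (enc_mat M)
       (enc_mat (mat (dim_row M) (dim_col M) (\<lambda>e. if e \<in> Es then 1 else 0)))))"

text \<open>
  A phylogeny for \<open>n\<close> rows is written as its root, a list of its nodes with their state vectors,
  a list of its arcs, and the list of the nodes labelled by rows \<open>0, \<dots>, n - 1\<close>. The order of the
  nodes and arcs is arbitrary.
\<close>

definition enc_phylogeny ::
    "nat \<Rightarrow> nat list \<Rightarrow> (nat \<times> nat) list \<Rightarrow> nat phylogeny \<Rightarrow> dat" where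
  "enc_phylogeny n vs es T =
     Dot (enc_nat (root T))
       (Dot (enc_list (\<lambda>x. Dot (enc_nat x) (enc_vec (state T x))) vs)
         (Dot (enc_list (\<lambda>(x, y). Dot (enc_nat x) (enc_nat y)) es)
           (enc_list (\<lambda>i. enc_nat (place T i)) [0..<n])))"

text \<open>The answer \<open>Atom\<close> reports that there is no solution.\<close>

definition reports_none :: "dat \<Rightarrow> bool" where
  "reports_none d \<longleftrightarrow> d = Atom"

definition reports_phylogeny :: "nat \<Rightarrow> dat \<Rightarrow> nat phylogeny \<Rightarrow> bool" where
  "reports_phylogeny n d T \<longleftrightarrow>
     (\<exists>vs es. set vs = nodes T \<and> set es = arcs T \<and> d = enc_phylogeny n vs es T)"

end

theory Submission
  imports Defs
begin

text \<open>
  Write \<open>c\<^sub>j\<close> for the set of species with character \<open>j\<close> and \<open>S\<close> for the set of all species. In a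
  phylogeny, \<open>c\<^sub>j\<close> is the difference of two clades \<open>A\<^sub>j \<supseteq> B\<^sub>j\<close>, the second one possibly empty,
  all clades together are laminar, and a constraint on \<open>(i, j)\<close> says \<open>i \<notin> B\<^sub>j\<close>. If \<open>c\<^sub>j\<close> and \<open>c\<^sub>k\<close>
  meet, cover \<open>S\<close> and are not nested, then one of \<open>A\<^sub>j, A\<^sub>k\<close> contains the other, hence is \<open>S\<close>, and
  that character is lost on the whole complement of its set, so it has no constraint.
  Therefore two constrained characters must not be of this kind. Conversely, this suffices: the
  characters are compatible splits of \<open>S\<close>, and a root of the corresponding tree has to be chosen on
  the zero side of every constrained split. These halves of the tree meet pairwise, so they have a
  common point. Concretely, a split that has a side inside some constrained \<open>c\<^sub>k\<close> is directed
  towards that side, and every other one away from species 0. A character \<open>j\<close> that is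
  present at the chosen point is called full: it is gained on an arc that leads from the all-zero
  root to this point, and it is lost on the complement of \<open>c\<^sub>j\<close>.

  The running time is treated by closure properties: functions that are computable in polynomial
  time with polynomially bounded results are closed under composition, case distinction and
  iteration with bounded growth, hence under bounded quantifiers, bounded search and tabulation,
  which suffice to write down the tree.
\<close>

section \<open>Functions computable in polynomial time\<close>

fun shift :: "nat \<Rightarrow> expr \<Rightarrow> expr" where
  "shift q EParam = EParam"
| "shift q EAtom = EAtom"
| "shift q (EDot e f) = EDot (shift q e) (shift q f)"
| "shift q (EHead e) = EHead (shift q e)"
| "shift q (ETail e) = ETail (shift q e)"
| "shift q (EIf c e f) = EIf (shift q c) (shift q e) (shift q f)"
| "shift q (ECall k e) = ECall (q + k) (shift q e)"

lemma eval_append: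
  assumes "eval P e x v t"
  shows "eval (P @ R) e x v t"
  using assms
proof induction
  case (eval_call e x a s k b t)
  then show ?case by (intro eval.eval_call) (auto simp: nth_append)
qed (auto intro: eval.intros[simplified])

lemma eval_shift:
  assumes "eval P e x v t"
  shows "eval (Q @ map (shift (length Q)) P) (shift (length Q) e) x v t"
  using assms
proof induction
  case (eval_call e x a s k b t)
  then have "eval (Q @ map (shift (length Q)) P) (ECall (length Q + k) (shift (length Q) e)) x b
      (s + t + 1)"
    by (intro eval.eval_call) (auto simp: nth_append)
  then show ?case by simp
qed (auto intro: eval.intros[simplified])

lemma eval_eq:
  assumes "eval P e x v t" "w = v" "u = t"
  shows "eval P e x w u"
  using assms by simp

definition realises :: "program \<Rightarrow> expr \<Rightarrow> nat \<Rightarrow> (dat \<Rightarrow> dat) \<Rightarrow> bool" where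
  "realises P e k f \<longleftrightarrow>
     (\<forall>x. \<exists>t. eval P e x (f x) t \<and> t \<le> (size x + 2) ^ k \<and> size (f x) + 2 \<le> (size x + 2) ^ k)"

definition ptime :: "(dat \<Rightarrow> dat) \<Rightarrow> bool" where
  "ptime f \<longleftrightarrow> (\<exists>P e k. realises P e k f)"

lemma power_weaken: "(n::nat) \<le> (b + 2) ^ k \<Longrightarrow> k \<le> l \<Longrightarrow> n \<le> (b + 2) ^ l"
  by (erule order_trans) (simp add: power_increasing)

lemma realises_mono: "realises P e k f \<Longrightarrow> k \<le> l \<Longrightarrow> realises P e l f"
  unfolding realises_def by (meson power_weaken)

lemma realises_append: "realises P e k f \<Longrightarrow> realises (P @ R) e k f"
  unfolding realises_def by (meson eval_append)

lemma realises_shift: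
  "realises P e k f \<Longrightarrow> realises (Q @ map (shift (length Q)) P) (shift (length Q) e) k f"
  unfolding realises_def by (meson eval_shift)

lemma ptime_common2:
  assumes "ptime f" "ptime g"
  obtains P e e' k where "realises P e k f" "realises P e' k g"
proof -
  from assms obtain P e k Q e' l where *: "realises P e k f" "realises Q e' l g"
    unfolding ptime_def by blast
  have "realises (P @ map (shift (length P)) Q) e (k + l) f"
    using *(1) by (intro realises_append) (auto intro: realises_mono)
  moreover have "realises (P @ map (shift (length P)) Q) (shift (length P) e') (k + l) g"
    using *(2) by (intro realises_shift) (auto intro: realises_mono)
  ultimately show ?thesis by (rule that)
qed

lemma ptime_common3:
  assumes "ptime f" "ptime g" "ptime h"
  obtains P e e' e'' k where "realises P e k f" "realises P e' k g" "realises P e'' k h"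
proof -
  from assms(1,2) obtain P e e' k where 1: "realises P e k f" "realises P e' k g"
    by (rule ptime_common2)
  from assms(3) obtain Q e'' l where 2: "realises Q e'' l h"
    unfolding ptime_def by blast
  let ?R = "P @ map (shift (length P)) Q"
  have "realises ?R e (k + l) f" "realises ?R e' (k + l) g"
    using 1 by (auto intro: realises_append realises_mono)
  moreover have "realises ?R (shift (length P) e'') (k + l) h"
    using 2 by (intro realises_shift) (auto intro: realises_mono)
  ultimately show ?thesis by (rule that)
qed

lemma realisesE:
  assumes "realises P e k f"
  obtains t where "eval P e x (f x) t" "t \<le> (size x + 2) ^ k" "size (f x) + 2 \<le> (size x + 2) ^ k"
  using assms unfolding realises_def by blast

lemma eight_power_le: "8 * ((b::nat) + 2) ^ k \<le> (b + 2) ^ (k + 3)"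
proof -
  have "(2::nat) ^ 3 \<le> (b + 2) ^ 3" by (rule power_mono) auto
  then show ?thesis by (simp add: power_add)
qed

lemma power_ge_1: "1 \<le> ((b::nat) + 2) ^ k"
  by simp

lemma ptimeI:
  assumes "\<And>x. \<exists>t. eval P e x (f x) t \<and> t \<le> 8 * (size x + 2) ^ k
    \<and> size (f x) + 2 \<le> 8 * (size x + 2) ^ k"
  shows "ptime f"
  unfolding ptime_def realises_def
proof (rule exI[of _ P], rule exI[of _ e], rule exI[of _ "k + 3"], rule allI)
  fix x :: dat
  show "\<exists>t. eval P e x (f x) t \<and> t \<le> (size x + 2) ^ (k + 3)
    \<and> size (f x) + 2 \<le> (size x + 2) ^ (k + 3)"
    using assms[of x] order_trans[OF _ eight_power_le[of "size x" k]] by blast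
qed

lemma ptime_id: "ptime (\<lambda>x. x)"
  by (rule ptimeI[where P = "[]" and e = EParam and k = 1]) (auto intro: eval_param)

lemma ptime_Atom: "ptime (\<lambda>x. Atom)"
  by (rule ptimeI[where P = "[]" and e = EAtom and k = 1]) (auto intro: eval_atom)

lemma ptime_Dot:
  assumes "ptime f" "ptime g"
  shows "ptime (\<lambda>x. Dot (f x) (g x))"
proof -
  from assms obtain P e e' k where r: "realises P e k f" "realises P e' k g"
    by (rule ptime_common2)
  show ?thesis
  proof (rule ptimeI[where P = P and e = "EDot e e'" and k = k])
    fix x :: dat
    obtain s where s: "eval P e x (f x) s" "s \<le> (size x + 2) ^ k"
        "size (f x) + 2 \<le> (size x + 2) ^ k"
      by (rule realisesE[OF r(1)])
    obtain t where t: "eval P e' x (g x) t" "t \<le> (size x + 2) ^ k"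
        "size (g x) + 2 \<le> (size x + 2) ^ k"
      by (rule realisesE[OF r(2)])
    have "s + t + 1 \<le> 8 * (size x + 2) ^ k"
      "size (Dot (f x) (g x)) + 2 \<le> 8 * (size x + 2) ^ k"
      using s t power_ge_1[of "size x" k] unfolding dat.size by linarith+
    with eval_dot[OF s(1) t(1)]
    show "\<exists>t. eval P (EDot e e') x (Dot (f x) (g x)) t \<and> t \<le> 8 * (size x + 2) ^ k
        \<and> size (Dot (f x) (g x)) + 2 \<le> 8 * (size x + 2) ^ k"
      by blast
  qed
qed

lemma size_head_le: "size (head x) \<le> size x"
  by (cases x) auto

lemma size_tail_le: "size (tail x) \<le> size x"
  by (cases x) auto

lemma ptime_head:
  assumes "ptime f"
  shows "ptime (\<lambda>x. head (f x))"
proof -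
  from assms obtain P e k where r: "realises P e k f" unfolding ptime_def by blast
  show ?thesis
  proof (rule ptimeI[where P = P and e = "EHead e" and k = k])
    fix x :: dat
    obtain s where s: "eval P e x (f x) s" "s \<le> (size x + 2) ^ k"
        "size (f x) + 2 \<le> (size x + 2) ^ k"
      by (rule realisesE[OF r])
    have "s + 1 \<le> 8 * (size x + 2) ^ k" "size (head (f x)) + 2 \<le> 8 * (size x + 2) ^ k"
      using s size_head_le[of "f x"] power_ge_1[of "size x" k] by linarith+
    with eval_head[OF s(1)]
    show "\<exists>t. eval P (EHead e) x (head (f x)) t \<and> t \<le> 8 * (size x + 2) ^ k
        \<and> size (head (f x)) + 2 \<le> 8 * (size x + 2) ^ k"
      by blast
  qed
qed

lemma ptime_tail:
  assumes "ptime f"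
  shows "ptime (\<lambda>x. tail (f x))"
proof -
  from assms obtain P e k where r: "realises P e k f" unfolding ptime_def by blast
  show ?thesis
  proof (rule ptimeI[where P = P and e = "ETail e" and k = k])
    fix x :: dat
    obtain s where s: "eval P e x (f x) s" "s \<le> (size x + 2) ^ k"
        "size (f x) + 2 \<le> (size x + 2) ^ k"
      by (rule realisesE[OF r])
    have "s + 1 \<le> 8 * (size x + 2) ^ k" "size (tail (f x)) + 2 \<le> 8 * (size x + 2) ^ k"
      using s size_tail_le[of "f x"] power_ge_1[of "size x" k] by linarith+
    with eval_tail[OF s(1)]
    show "\<exists>t. eval P (ETail e) x (tail (f x)) t \<and> t \<le> 8 * (size x + 2) ^ k
        \<and> size (tail (f x)) + 2 \<le> 8 * (size x + 2) ^ k"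
      by blast
  qed
qed

lemma ptime_if_Atom:
  assumes "ptime c" "ptime f" "ptime g"
  shows "ptime (\<lambda>x. if c x = Atom then g x else f x)"
proof -
  from assms obtain P ec e e' k
    where r: "realises P ec k c" "realises P e k f" "realises P e' k g"
    by (rule ptime_common3)
  show ?thesis
  proof (rule ptimeI[where P = P and e = "EIf ec e e'" and k = k])
    fix x :: dat
    let ?h = "if c x = Atom then g x else f x"
    obtain u where u: "eval P ec x (c x) u" "u \<le> (size x + 2) ^ k"
      by (rule realisesE[OF r(1)])
    obtain s where s: "eval P e x (f x) s" "s \<le> (size x + 2) ^ k"
        "size (f x) + 2 \<le> (size x + 2) ^ k"
      by (rule realisesE[OF r(2)])
    obtain t where t: "eval P e' x (g x) t" "t \<le> (size x + 2) ^ k"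
        "size (g x) + 2 \<le> (size x + 2) ^ k"
      by (rule realisesE[OF r(3)])
    have "eval P (EIf ec e e') x ?h (u + (if c x = Atom then t else s) + 1)"
      using u s t by (auto intro: eval_if_true[simplified] eval_if_false[simplified])
    moreover have "u + (if c x = Atom then t else s) + 1 \<le> 8 * (size x + 2) ^ k"
      "size ?h + 2 \<le> 8 * (size x + 2) ^ k"
      using u s t power_ge_1[of "size x" k] by (simp_all split: if_split)
    ultimately
    show "\<exists>t. eval P (EIf ec e e') x ?h t \<and> t \<le> 8 * (size x + 2) ^ k
        \<and> size ?h + 2 \<le> 8 * (size x + 2) ^ k"
      by blast
  qed
qed

lemma ptime_comp:
  assumes "ptime f" "ptime g"
  shows "ptime (\<lambda>x. f (g x))"
proof -
  from assms obtain P e e' k where r: "realises P e k f" "realises P e' k g"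
    by (rule ptime_common2)
  let ?P = "P @ [e]" and ?e = "ECall (length P) e'"
  note r' = r[THEN realises_append[where R = "[e]"]]
  show ?thesis
  proof (rule ptimeI[where P = ?P and e = ?e and k = "k + k * k"])
    fix x :: dat
    let ?B = "(size x + 2) ^ (k + k * k)"
    obtain s where s: "eval ?P e' x (g x) s" "s \<le> (size x + 2) ^ k"
        "size (g x) + 2 \<le> (size x + 2) ^ k"
      by (rule realisesE[OF r'(2)])
    obtain t where t: "eval ?P e (g x) (f (g x)) t" "t \<le> (size (g x) + 2) ^ k"
        "size (f (g x)) + 2 \<le> (size (g x) + 2) ^ k"
      by (rule realisesE[OF r'(1)])
    have "(size (g x) + 2) ^ k \<le> ((size x + 2) ^ k) ^ k"
      by (rule power_mono) (use s in auto)
    also have "\<dots> = (size x + 2) ^ (k * k)" by (simp add: power_mult)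
    also have "\<dots> \<le> ?B" by (rule power_increasing) auto
    finally have "(size (g x) + 2) ^ k \<le> ?B" .
    moreover have "s \<le> ?B" by (rule power_weaken[OF s(2)]) simp
    ultimately have "s + t + 1 \<le> 8 * ?B" "size (f (g x)) + 2 \<le> 8 * ?B"
      using t power_ge_1[of "size x" "k + k * k"] by linarith+
    moreover have "eval ?P ?e x (f (g x)) (s + t + 1)"
      by (rule eval_call[OF s(1)]) (use t in auto)
    ultimately show "\<exists>t. eval ?P ?e x (f (g x)) t \<and> t \<le> 8 * ?B \<and> size (f (g x)) + 2 \<le> 8 * ?B"
      by blast
  qed
qed

fun dec_nat :: "dat \<Rightarrow> nat" where
  "dec_nat Atom = 0"
| "dec_nat (Dot a b) = Suc (dec_nat b)"

lemma dec_nat_enc_nat [simp]: "dec_nat (enc_nat n) = n"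
  by (induction n) auto

lemma size_enc_nat [simp]: "size (enc_nat n) = n"
  by (induction n) auto

lemma dec_nat_le_size: "dec_nat x \<le> size x"
  by (induction x) auto

lemma eval_loop:
  fixes f :: "dat \<Rightarrow> dat \<Rightarrow> dat" and P :: program and e :: expr
  defines "body \<equiv> EIf (ETail (ETail EParam))
    (ECall (Suc (length P)) (EDot (EHead EParam)
       (EDot (ECall (length P) (EDot (EHead EParam) (EHead (ETail EParam))))
         (ETail (ETail (ETail EParam))))))
    (EHead (ETail EParam))"
  assumes f: "realises P e k (\<lambda>y. f (head y) (tail y))"
    and growth: "\<And>a. size (f x a) \<le> size a + G"
    and "size a + dec_nat c * G \<le> A"
  shows "\<exists>t. eval (P @ [e, body]) body (Dot x (Dot a c)) ((f x ^^ dec_nat c) a) t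
    \<and> t \<le> (dec_nat c + 1) * ((size x + A + 3) ^ k + 20)
    \<and> size ((f x ^^ dec_nat c) a) \<le> size a + dec_nat c * G"
  using assms(4)
proof (induction c arbitrary: a)
  case Atom
  have "eval (P @ [e, body]) (ETail (ETail EParam)) (Dot x (Dot a Atom)) Atom 3"
    by (rule eval_eq, (rule eval.intros)+) auto
  moreover have "eval (P @ [e, body]) (EHead (ETail EParam)) (Dot x (Dot a Atom)) a 3"
    by (rule eval_eq, (rule eval.intros)+) auto
  ultimately have "eval (P @ [e, body]) body (Dot x (Dot a Atom)) a (3 + 3 + 1)"
    unfolding body_def by (rule eval_if_false)
  then show ?case by auto
next
  case (Dot u c)
  let ?P = "P @ [e, body]" and ?y = "Dot x (Dot a (Dot u c))"
  let ?a = "f x a" and ?C = "(size x + A + 3) ^ k"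
  have sz: "size a \<le> A" using Dot.prems by simp
  obtain s where s: "eval ?P e (Dot x a) (f x a) s" "s \<le> (size (Dot x a) + 2) ^ k"
    using realisesE[OF realises_append[OF f, of "[e, body]"], of "Dot x a"] by auto
  have "(size (Dot x a) + 2) ^ k \<le> ?C"
    by (rule power_mono) (use sz in auto)
  with s have sC: "s \<le> ?C" by linarith
  have "size ?a + dec_nat c * G \<le> A"
    using growth[of a] Dot.prems by (simp add: algebra_simps)
  from Dot.IH(2)[OF this] obtain t
    where t: "eval ?P body (Dot x (Dot ?a c)) ((f x ^^ dec_nat c) ?a) t"
      "t \<le> (dec_nat c + 1) * (?C + 20)"
      "size ((f x ^^ dec_nat c) ?a) \<le> size ?a + dec_nat c * G"
    by blast
  have "eval ?P (EDot (EHead EParam) (EHead (ETail EParam))) ?y (Dot x a) 6"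
    by (rule eval_eq, (rule eval.intros)+) auto
  then have "eval ?P (ECall (length P) (EDot (EHead EParam) (EHead (ETail EParam)))) ?y ?a
      (6 + s + 1)"
    by (intro eval_call[where a = "Dot x a"]) (use s in \<open>auto simp: nth_append\<close>)
  moreover have "eval ?P (ETail (ETail (ETail EParam))) ?y c 4"
    by (rule eval_eq, (rule eval.intros)+) auto
  moreover have "eval ?P (EHead EParam) ?y x 2"
    by (rule eval_eq, (rule eval.intros)+) auto
  ultimately have "eval ?P (EDot (EHead EParam)
       (EDot (ECall (length P) (EDot (EHead EParam) (EHead (ETail EParam))))
         (ETail (ETail (ETail EParam))))) ?y (Dot x (Dot ?a c))
      (2 + ((6 + s + 1) + 4 + 1) + 1)"
    by (intro eval_dot)
  then have "eval ?P (ECall (Suc (length P)) (EDot (EHead EParam)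
       (EDot (ECall (length P) (EDot (EHead EParam) (EHead (ETail EParam))))
         (ETail (ETail (ETail EParam)))))) ?y ((f x ^^ dec_nat c) ?a)
      (2 + (6 + s + 1 + 4 + 1) + 1 + t + 1)"
    by (intro eval_call[where a = "Dot x (Dot ?a c)"])
      (use t in \<open>auto simp: nth_append\<close>)
  moreover have "eval ?P (ETail (ETail EParam)) ?y (Dot u c) 3"
    by (rule eval_eq, (rule eval.intros)+) auto
  ultimately have "eval ?P body ?y ((f x ^^ dec_nat c) ?a)
      (3 + (2 + (6 + s + 1 + 4 + 1) + 1 + t + 1) + 1)"
    unfolding body_def by (intro eval_if_true) auto
  moreover have "(f x ^^ dec_nat c) ?a = (f x ^^ dec_nat (Dot u c)) a"
    by (simp add: funpow_swap1)
  moreover have "3 + (2 + (6 + s + 1 + 4 + 1) + 1 + t + 1) + 1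
      \<le> (dec_nat (Dot u c) + 1) * (?C + 20)"
    using t(2) sC by simp
  moreover have "size ((f x ^^ dec_nat c) ?a) \<le> size a + dec_nat (Dot u c) * G"
    using t(3) growth[of a] by simp
  ultimately show ?case by metis
qed

lemma ptime_iter:
  assumes f: "ptime (\<lambda>y. f (head y) (tail y))" and "ptime i" "ptime c"
    and growth: "\<And>x a. size (f x a) \<le> size a + (size x + 2) ^ g"
  shows "ptime (\<lambda>x. (f x ^^ dec_nat (c x)) (i x))"
proof -
  from assms(1-3) obtain P e ei ec k
    where r: "realises P e k (\<lambda>y. f (head y) (tail y))" "realises P ei k i" "realises P ec k c"
    by (rule ptime_common3)
  obtain body where loop: "\<And>(x::dat) G a c A. (\<And>a. size (f x a) \<le> size a + G) \<Longrightarrow>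
    size a + dec_nat c * G \<le> A \<Longrightarrow>
    \<exists>t. eval (P @ [e, body]) body (Dot x (Dot a c)) ((f x ^^ dec_nat c) a) t
    \<and> t \<le> (dec_nat c + 1) * ((size x + A + 3) ^ k + 20)
    \<and> size ((f x ^^ dec_nat c) a) \<le> size a + dec_nat c * G"
    using eval_loop[OF r(1)] by metis
  let ?P = "P @ [e, body]" and ?e = "ECall (Suc (length P)) (EDot EParam (EDot ei ec))"
  note r' = r[THEN realises_append[where R = "[e, body]"]]
  define q where "q = (k + g + 4) * k"
  define p where "p = k + q + 5 + g"
  show ?thesis
  proof (rule ptimeI[where P = ?P and e = ?e and k = p])
    fix x :: dat
    let ?B = "size x + 2"
    obtain s where s: "eval ?P ei x (i x) s" "s \<le> ?B ^ k" "size (i x) + 2 \<le> ?B ^ k"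
      by (rule realisesE[OF r'(2)])
    obtain t where t: "eval ?P ec x (c x) t" "t \<le> ?B ^ k" "size (c x) + 2 \<le> ?B ^ k"
      by (rule realisesE[OF r'(3)])
    define A where "A = size (i x) + dec_nat (c x) * ?B ^ g"
    obtain u where u: "eval ?P body (Dot x (Dot (i x) (c x))) ((f x ^^ dec_nat (c x)) (i x)) u"
      "u \<le> (dec_nat (c x) + 1) * ((size x + A + 3) ^ k + 20)"
      "size ((f x ^^ dec_nat (c x)) (i x)) \<le> A"
      using loop[OF growth order_refl, of x "i x" "c x"] unfolding A_def by blast
    have cx: "dec_nat (c x) + 2 \<le> ?B ^ k" using t(3) dec_nat_le_size[of "c x"] by linarith
    have "dec_nat (c x) * ?B ^ g \<le> ?B ^ k * ?B ^ g"
      by (rule mult_right_mono) (use cx in auto)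
    moreover have "?B ^ k \<le> ?B ^ (k + g)" by (rule power_increasing) auto
    ultimately have A: "A + 2 \<le> 2 * ?B ^ (k + g)"
      unfolding A_def using s(3) by (simp only: power_add)
    have "?B \<le> ?B ^ (k + g + 1)" using power_increasing[of 1 "k + g + 1" ?B] by simp
    moreover have "?B ^ (k + g) \<le> ?B ^ (k + g + 1)" by (rule power_increasing) auto
    ultimately have "size x + A + 3 \<le> 8 * ?B ^ (k + g + 1)" using A by linarith
    also have "\<dots> \<le> ?B ^ (k + g + 4)"
      using eight_power_le[of "size x" "k + g + 1"] by (simp only: add.assoc) simp
    finally have "(size x + A + 3) ^ k \<le> (?B ^ (k + g + 4)) ^ k" by (rule power_mono) auto
    then have C: "(size x + A + 3) ^ k \<le> ?B ^ q" by (simp only: q_def power_mult)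
    have "u \<le> ?B ^ k * (?B ^ q + 20)"
      using u(2) mult_mono[OF _ add_right_mono[OF C, of 20], of "dec_nat (c x) + 1" "?B ^ k"] cx
      by linarith
    also have "\<dots> \<le> ?B ^ k * (?B ^ q * 32)"
      by (rule mult_left_mono) (use power_ge_1[of "size x" q] in linarith)+
    also have "\<dots> = ?B ^ k * (?B ^ q * 2 ^ 5)" by simp
    also have "\<dots> \<le> ?B ^ k * (?B ^ q * ?B ^ 5)"
      by (intro mult_left_mono power_mono) auto
    also have "\<dots> = ?B ^ (k + q + 5)" by (simp only: power_add mult.assoc)
    also have "\<dots> \<le> ?B ^ p" unfolding p_def by (rule power_increasing) auto
    finally have "u \<le> ?B ^ p" .
    moreover have "?B ^ k \<le> ?B ^ p" "?B ^ (k + g) \<le> ?B ^ p"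
      unfolding p_def by (rule power_increasing; simp)+
    ultimately have "1 + (s + t + 1) + 1 + u + 1 \<le> 8 * ?B ^ p"
      "size ((f x ^^ dec_nat (c x)) (i x)) + 2 \<le> 8 * ?B ^ p"
      using s t A u(3) power_ge_1[of "size x" k] power_ge_1[of "size x" p] by linarith+
    moreover have "eval ?P ?e x ((f x ^^ dec_nat (c x)) (i x)) (1 + (s + t + 1) + 1 + u + 1)"
      by (rule eval_call[where a = "Dot x (Dot (i x) (c x))"])
        (use u in \<open>auto simp: nth_append simp del: One_nat_def
           intro!: eval_dot eval_param s(1) t(1)\<close>)
    ultimately
    show "\<exists>t. eval ?P ?e x ((f x ^^ dec_nat (c x)) (i x)) t \<and> t \<le> 8 * ?B ^ p \<and>
       size ((f x ^^ dec_nat (c x)) (i x)) + 2 \<le> 8 * ?B ^ p"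
      by blast
  qed
qed

definition pdec :: "(dat \<Rightarrow> bool) \<Rightarrow> bool" where
  "pdec Q \<longleftrightarrow> ptime (\<lambda>x. if Q x then Dot Atom Atom else Atom)"

definition pnat :: "(dat \<Rightarrow> nat) \<Rightarrow> bool" where
  "pnat n \<longleftrightarrow> ptime (\<lambda>x. enc_nat (n x))"

lemma pnat_comp: "pnat n \<Longrightarrow> ptime g \<Longrightarrow> pnat (\<lambda>x. n (g x))"
  unfolding pnat_def by (rule ptime_comp)

lemma ptime_enc_nat: "pnat n \<Longrightarrow> ptime (\<lambda>x. enc_nat (n x))"
  unfolding pnat_def .

lemma ptime_If:
  assumes "pdec Q" "ptime f" "ptime g"
  shows "ptime (\<lambda>x. if Q x then f x else g x)"
proof -
  have "(\<lambda>x. if (if Q x then Dot Atom Atom else Atom) = Atom then g x else f x)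
      = (\<lambda>x. if Q x then f x else g x)"
    by auto
  with ptime_if_Atom[OF assms(1)[unfolded pdec_def] assms(2,3)] show ?thesis by metis
qed

lemma pdec_False: "pdec (\<lambda>x. False)"
  unfolding pdec_def by (simp add: ptime_Atom)

lemma pdec_True: "pdec (\<lambda>x. True)"
  unfolding pdec_def by (simp add: ptime_Atom ptime_Dot)

lemma pdec_If:
  assumes "pdec Q" "pdec R" "pdec R'"
  shows "pdec (\<lambda>x. if Q x then R x else R' x)"
proof -
  have "(\<lambda>x. if if Q x then R x else R' x then Dot Atom Atom else Atom)
      = (\<lambda>x. if Q x then if R x then Dot Atom Atom else Atom
          else if R' x then Dot Atom Atom else Atom)"
    by auto
  with ptime_If[OF assms(1) assms(2,3)[unfolded pdec_def]] show ?thesis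
    unfolding pdec_def by metis
qed

lemma pdec_not: "pdec Q \<Longrightarrow> pdec (\<lambda>x. \<not> Q x)"
  using pdec_If[OF _ pdec_False pdec_True, of Q] by (simp add: if_bool_eq_conj)

lemma pdec_conj: "pdec Q \<Longrightarrow> pdec R \<Longrightarrow> pdec (\<lambda>x. Q x \<and> R x)"
  using pdec_If[OF _ _ pdec_False, of Q R] by (simp add: if_bool_eq_disj)

lemma pdec_disj: "pdec Q \<Longrightarrow> pdec R \<Longrightarrow> pdec (\<lambda>x. Q x \<or> R x)"
  using pdec_not[OF pdec_conj[OF pdec_not pdec_not], of Q R] by simp

lemma pdec_imp: "pdec Q \<Longrightarrow> pdec R \<Longrightarrow> pdec (\<lambda>x. Q x \<longrightarrow> R x)"
  unfolding imp_conv_disj by (intro pdec_disj pdec_not)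

lemma pdec_iff: "pdec Q \<Longrightarrow> pdec R \<Longrightarrow> pdec (\<lambda>x. Q x = R x)"
  unfolding iff_conv_conj_imp by (intro pdec_conj pdec_imp)

lemma pdec_not_Atom:
  assumes "ptime c"
  shows "pdec (\<lambda>x. c x \<noteq> Atom)"
proof -
  have "(\<lambda>x. if c x \<noteq> Atom then Dot Atom Atom else Atom)
      = (\<lambda>x. if c x = Atom then Atom else Dot Atom Atom)"
    by auto
  with ptime_if_Atom[OF assms ptime_Dot[OF ptime_Atom ptime_Atom] ptime_Atom] show ?thesis
    unfolding pdec_def by simp
qed

lemma pnat_0: "pnat (\<lambda>x. 0)"
  unfolding pnat_def by (simp add: ptime_Atom)

lemma pnat_Suc: "pnat n \<Longrightarrow> pnat (\<lambda>x. Suc (n x))"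
  unfolding pnat_def by (simp add: ptime_Dot ptime_Atom)

lemma pnat_If: "pdec Q \<Longrightarrow> pnat n \<Longrightarrow> pnat n' \<Longrightarrow> pnat (\<lambda>x. if Q x then n x else n' x)"
  using ptime_If[of Q "\<lambda>x. enc_nat (n x)" "\<lambda>x. enc_nat (n' x)"]
  unfolding pnat_def by (simp add: if_distrib)

lemma enc_nat_eq_funpow: "enc_nat n = (Dot Atom ^^ n) Atom"
  by (induction n) auto

lemma pnat_dec_nat:
  assumes "ptime f"
  shows "pnat (\<lambda>x. dec_nat (f x))"
  unfolding pnat_def enc_nat_eq_funpow
  by (rule ptime_iter[where g = 1])
    (simp_all add: assms ptime_Dot ptime_Atom ptime_tail ptime_id)

lemma ptime_funpow_tail:
  assumes "pnat n" "ptime f"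
  shows "ptime (\<lambda>x. (tail ^^ n x) (f x))"
  using ptime_iter[of "\<lambda>x. tail" f "\<lambda>x. enc_nat (n x)" 0] assms size_tail_le
  by (simp add: pnat_def le_SucI ptime_tail ptime_id)

lemma funpow_tail_enc_nat: "(tail ^^ i) (enc_nat j) = enc_nat (j - i)"
proof (induction i)
  case (Suc i)
  then show ?case by (cases "j - i") (auto simp: diff_Suc)
qed auto

lemma pnat_diff: "pnat n \<Longrightarrow> pnat k \<Longrightarrow> pnat (\<lambda>x. n x - k x)"
  using ptime_funpow_tail[of k "\<lambda>x. enc_nat (n x)"]
  unfolding funpow_tail_enc_nat by (simp add: pnat_def)

lemma enc_nat_eq_Atom: "enc_nat n = Atom \<longleftrightarrow> n = 0"
  by (cases n) auto

lemma pdec_less: "pnat n \<Longrightarrow> pnat k \<Longrightarrow> pdec (\<lambda>x. n x < k x)"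
  using pdec_not_Atom[OF ptime_enc_nat[OF pnat_diff[of k n]]] by (simp add: enc_nat_eq_Atom not_le)

lemma pdec_le: "pnat n \<Longrightarrow> pnat k \<Longrightarrow> pdec (\<lambda>x. n x \<le> k x)"
  using pdec_not[OF pdec_less[of k n]] by (simp add: not_less)

lemma pdec_eq: "pnat n \<Longrightarrow> pnat k \<Longrightarrow> pdec (\<lambda>x. n x = k x)"
  using pdec_conj[OF pdec_le[of n k] pdec_le[of k n]] by (simp add: order_eq_iff)

primrec search :: "(nat \<Rightarrow> bool) \<Rightarrow> nat \<Rightarrow> nat" where
  "search Q 0 = 0"
| "search Q (Suc n) = (if Q (search Q n) then search Q n else Suc (search Q n))"

lemma search_le: "search Q n \<le> n"
  by (induction n) auto

lemma search_sound: "search Q n < n \<Longrightarrow> Q (search Q n)"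
proof (induction n)
  case (Suc n)
  then show ?case using search_le[of Q n] by (auto split: if_splits)
qed simp

lemma search_complete: "k < search Q n \<Longrightarrow> \<not> Q k"
  by (induction n) (auto simp: less_Suc_eq split: if_splits)

lemma search_less_iff: "search Q n < n \<longleftrightarrow> (\<exists>k<n. Q k)"
  using search_sound[of Q n] search_complete[of _ Q n] search_le[of Q n]
  by (metis le_neq_implies_less)

lemma pnat_search:
  assumes Q: "pdec (\<lambda>y. Q (head y) (dec_nat (tail y)))" and n: "pnat n"
  shows "pnat (\<lambda>x. search (Q x) (n x))"
proof -
  let ?f = "\<lambda>x a. if Q x (dec_nat a) then a else Dot Atom a"
  have "enc_nat (search (Q x) k) = (?f x ^^ k) Atom" for x k
  proof (induction k)
    case (Suc k)
    show ?case by (simp flip: Suc.IH)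
  qed simp
  then have "enc_nat (search (Q x) (n x)) = (?f x ^^ dec_nat (enc_nat (n x))) Atom" for x
    by simp
  moreover have "ptime (\<lambda>x. (?f x ^^ dec_nat (enc_nat (n x))) Atom)"
  proof (rule ptime_iter)
    show "ptime (\<lambda>y. if Q (head y) (dec_nat (tail y)) then tail y else Dot Atom (tail y))"
      by (intro ptime_If Q ptime_tail ptime_id ptime_Dot ptime_Atom)
    show "size (?f x a) \<le> size a + (size x + 2) ^ 0" for x a by auto
  qed (use n in \<open>auto simp: pnat_def intro: ptime_Atom\<close>)
  ultimately show ?thesis unfolding pnat_def by simp
qed

lemma pdec_ex:
  assumes "pnat n" "pdec (\<lambda>y. Q (head y) (dec_nat (tail y)))"
  shows "pdec (\<lambda>x. \<exists>i<n x. Q x i)"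
  using pdec_less[OF pnat_search[OF assms(2,1)] assms(1)] by (simp add: search_less_iff)

lemma pdec_all:
  assumes "pnat n" "pdec (\<lambda>y. Q (head y) (dec_nat (tail y)))"
  shows "pdec (\<lambda>x. \<forall>i<n x. Q x i)"
  using pdec_not[OF pdec_ex[OF assms(1) pdec_not[OF assms(2)]]] by simp

lemma ptime_size:
  assumes "ptime f"
  obtains k where "\<And>x. size (f x) + 2 \<le> (size x + 2) ^ k"
  using assms unfolding ptime_def realises_def by meson

lemma dec_nat_enc_list [simp]: "dec_nat (enc_list h xs) = length xs"
  by (induction xs) auto

lemma ptime_tabulate:
  assumes n: "pnat n" and h: "ptime (\<lambda>y. h (head y) (dec_nat (tail y)))"
  shows "ptime (\<lambda>x. enc_list (h x) [0..<n x])"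
proof -
  let ?f = "\<lambda>x a. Dot (h x (n x - Suc (dec_nat a))) a"
  have "k \<le> n x \<Longrightarrow> (?f x ^^ k) Atom = enc_list (h x) [n x - k..<n x]" for x k
  proof (induction k)
    case (Suc k)
    then have "[n x - Suc k..<n x] = (n x - Suc k) # [n x - k..<n x]"
      by (simp add: upt_conv_Cons Suc_diff_Suc)
    with Suc show ?case by simp
  qed simp
  from this[of "n _"] have "enc_list (h x) [0..<n x] = (?f x ^^ dec_nat (enc_nat (n x))) Atom" for x
    by simp
  moreover obtain p where p: "size (h (head x) (dec_nat (tail x))) + 2 \<le> (size x + 2) ^ p" for x
    using ptime_size[OF h] by blast
  obtain q where q: "n x + 2 \<le> (size x + 2) ^ q" for x
    using ptime_size[OF n[unfolded pnat_def]] by auto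
  have "ptime (\<lambda>x. (?f x ^^ dec_nat (enc_nat (n x))) Atom)"
  proof (rule ptime_iter)
    show "ptime (\<lambda>y. Dot (h (head y) (n (head y) - Suc (dec_nat (tail y)))) (tail y))"
    proof (rule ptime_Dot)
      have "ptime (\<lambda>y. Dot (head y) (enc_nat (n (head y) - Suc (dec_nat (tail y)))))"
        by (intro ptime_Dot ptime_enc_nat pnat_diff pnat_Suc pnat_dec_nat pnat_comp[OF n]
            ptime_head ptime_tail ptime_id)
      from ptime_comp[OF h this]
      show "ptime (\<lambda>y. h (head y) (n (head y) - Suc (dec_nat (tail y))))" by simp
    qed (intro ptime_tail ptime_id)
    show "size (?f x a) \<le> size a + (size x + 2) ^ ((q + 4) * p)" for x a
    proof -
      let ?i = "n x - Suc (dec_nat a)" and ?B = "size x + 2"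
      have "size (h x ?i) + 2 \<le> (size x + ?i + 3) ^ p"
        using p[of "Dot x (enc_nat ?i)"] by (simp add: numeral_3_eq_3)
      also have "size x + ?i + 3 \<le> ?B ^ (q + 4)"
      proof -
        have "?B \<le> ?B ^ (q + 1)" "?B ^ q \<le> ?B ^ (q + 1)"
          using power_increasing[of 1 "q + 1" ?B] by simp_all
        then have "size x + ?i + 3 \<le> 8 * ?B ^ (q + 1)"
          using q[of x] by linarith
        also have "\<dots> \<le> ?B ^ (q + 4)"
          using eight_power_le[of "size x" "q + 1"] by (simp only: add.assoc) simp
        finally show ?thesis .
      qed
      then have "(size x + ?i + 3) ^ p \<le> (?B ^ (q + 4)) ^ p" by (rule power_mono) auto
      finally show ?thesis by (simp only: power_mult dat.size)
    qed
  qed (use n in \<open>auto simp: pnat_def intro: ptime_Atom\<close>)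
  ultimately show ?thesis by simp
qed

lemmas ptime_intros =
  ptime_id ptime_Atom ptime_Dot ptime_head ptime_tail ptime_enc_nat ptime_If ptime_tabulate
  pdec_not pdec_conj pdec_disj pdec_imp pdec_iff pdec_eq pdec_less pdec_le pdec_ex pdec_all
  pnat_0 pnat_Suc pnat_If pnat_dec_nat pnat_search

section \<open>The tree of a feasible instance\<close>

locale character_table =
  fixes n m :: nat and a e :: "nat \<Rightarrow> nat \<Rightarrow> bool"
begin

definition constrained :: "nat \<Rightarrow> bool" where
  "constrained k \<longleftrightarrow> (\<exists>i<n. e i k)"

definition contained :: "nat \<Rightarrow> nat \<Rightarrow> bool" where
  "contained j k \<longleftrightarrow> (\<forall>i<n. a i j \<longrightarrow> a i k)"

definition covering :: "nat \<Rightarrow> nat \<Rightarrow> bool" where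
  "covering j k \<longleftrightarrow> (\<forall>i<n. a i j \<or> a i k)"

definition meeting :: "nat \<Rightarrow> nat \<Rightarrow> bool" where
  "meeting j k \<longleftrightarrow> (\<exists>i<n. a i j \<and> a i k)"

definition feasible :: bool where
  "feasible \<longleftrightarrow> (\<forall>j<m. \<forall>k<m.
     constrained j \<and> constrained k \<and> covering j k \<longrightarrow> \<not> meeting j k)"

definition full :: "nat \<Rightarrow> bool" where
  "full j \<longleftrightarrow> \<not> (\<exists>k<m. constrained k \<and> contained j k) \<and>
     ((\<exists>k<m. constrained k \<and> covering j k) \<or> (0 < n \<and> a 0 j))"

definition side :: "nat \<Rightarrow> nat \<Rightarrow> bool" where
  "side i j \<longleftrightarrow> a i j \<noteq> full j"

text \<open>
  Each character has its own node, below which its value differs from the one at the top. Nodes with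
  equal sets form a chain ordered by index; a node with an empty set is a leaf just below the top.
\<close>

definition below :: "nat \<Rightarrow> nat \<Rightarrow> bool" where
  "below j k \<longleftrightarrow> j = k \<or>
     (\<exists>i<n. side i j) \<and> (\<forall>i<n. side i j \<longrightarrow> side i k) \<and>
     ((\<forall>i<n. side i k \<longrightarrow> side i j) \<longrightarrow> j \<le> k)"

text \<open>
  The value \<open>m\<close> of \<open>search\<close>, which says that nothing was found, is the number of the top node. Above
  it there is a separate root \<open>Suc m\<close> if and only if the top node already carries some character.
\<close>

definition parent :: "nat \<Rightarrow> nat" where
  "parent j = search (\<lambda>k. k \<noteq> j \<and> below j k \<and> (\<forall>l<m. l \<noteq> j \<and> below j l \<longrightarrow> below k l)) m"

definition spot :: "nat \<Rightarrow> nat" where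
  "spot i = search (\<lambda>k. side i k \<and> (\<forall>l<m. side i l \<longrightarrow> below k l)) m"

definition some_full :: bool where
  "some_full \<longleftrightarrow> (\<exists>j<m. full j)"

definition root_node :: nat where
  "root_node = (if some_full then Suc m else m)"

definition has_state :: "nat \<Rightarrow> nat \<Rightarrow> bool" where
  "has_state v k \<longleftrightarrow> v \<le> m \<and> full k \<noteq> (v < m \<and> below v k)"

definition tree :: "nat phylogeny" where
  "tree = \<lparr>nodes = {..m} \<union> {root_node},
     arcs = (\<lambda>j. (parent j, j)) ` {..<m} \<union> (if some_full then {(Suc m, m)} else {}),
     root = root_node,
     state = (\<lambda>v. vec m (\<lambda>k. of_bool (has_state v k))),
     place = spot\<rparr>"

lemma tree_sel [simp]:
  "nodes tree = {..m} \<union> {root_node}"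
  "arcs tree = (\<lambda>j. (parent j, j)) ` {..<m} \<union> (if some_full then {(Suc m, m)} else {})"
  "root tree = root_node"
  "state tree = (\<lambda>v. vec m (\<lambda>k. of_bool (has_state v k)))"
  "place tree = spot"
  by (simp_all add: tree_def)

lemma below_refl: "below j j"
  by (simp add: below_def)

lemma below_antisym: "below j k \<Longrightarrow> below k j \<Longrightarrow> j = k"
  unfolding below_def by (elim disjE) auto

lemma below_trans:
  assumes "below j k" "below k l"
  shows "below j l"
proof (cases "j = k \<or> k = l")
  case True
  then show ?thesis using assms by auto
next
  case False
  then have j: "\<exists>i<n. side i j" "\<forall>i<n. side i j \<longrightarrow> side i k"
      "(\<forall>i<n. side i k \<longrightarrow> side i j) \<longrightarrow> j \<le> k"
    and k: "\<forall>i<n. side i k \<longrightarrow> side i l" "(\<forall>i<n. side i l \<longrightarrow> side i k) \<longrightarrow> k \<le> l"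
    using assms unfolding below_def by blast+
  have "j \<le> l" if "\<forall>i<n. side i l \<longrightarrow> side i j"
  proof -
    have "j \<le> k" using j(3) k(1) that by blast
    also have "k \<le> l" using k(2) j(2) that by blast
    finally show ?thesis .
  qed
  then show ?thesis using j(1,2) k(1) unfolding below_def by blast
qed

lemma side_below: "side i j \<Longrightarrow> i < n \<Longrightarrow> below j k \<Longrightarrow> side i k"
  unfolding below_def by blast

end

locale feasible_table = character_table +
  assumes compatible: "j < m \<Longrightarrow> k < m \<Longrightarrow>
      \<not> ((\<exists>i<n. a i j \<and> a i k) \<and> (\<exists>i<n. a i j \<and> \<not> a i k) \<and>
         (\<exists>i<n. \<not> a i j \<and> a i k) \<and> (\<exists>i<n. \<not> a i j \<and> \<not> a i k))"
    and constraint_zero: "i < n \<Longrightarrow> j < m \<Longrightarrow> e i j \<Longrightarrow> \<not> a i j"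
    and feasible: feasible
begin

lemma side_compatible:
  assumes "j < m" "k < m"
  shows "\<not> ((\<exists>i<n. side i j \<and> side i k) \<and> (\<exists>i<n. side i j \<and> \<not> side i k) \<and>
    (\<exists>i<n. \<not> side i j \<and> side i k) \<and> (\<exists>i<n. \<not> side i j \<and> \<not> side i k))"
  using compatible[OF assms] unfolding side_def by (cases "full j"; cases "full k"; simp; blast)

lemma not_full_if_constrained: "j < m \<Longrightarrow> constrained j \<Longrightarrow> \<not> full j"
  unfolding full_def contained_def by blast

lemma constrained_laminar:
  assumes "l < m" "l' < m" "constrained l" "constrained l'"
  shows "contained l l' \<or> contained l' l \<or> \<not> meeting l l'"
  using compatible[OF assms(1,2)] feasible assms
  unfolding feasible_def contained_def covering_def meeting_def by blast

lemma side_bounded_or_base: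
  assumes "j < m"
  obtains l where "l < m" "constrained l" "\<And>i. i < n \<Longrightarrow> side i j \<Longrightarrow> a i l"
  | "\<And>l. l < m \<Longrightarrow> constrained l \<Longrightarrow> \<not> contained j l \<and> \<not> covering j l"
    "0 < n \<Longrightarrow> \<not> side 0 j"
proof (cases "\<exists>l<m. constrained l \<and> contained j l")
  case True
  then show ?thesis using that(1) unfolding side_def full_def contained_def by blast
next
  case no: False
  show ?thesis
  proof (cases "\<exists>l<m. constrained l \<and> covering j l")
    case True
    then have "full j" using no by (auto simp: full_def)
    with True show ?thesis using that(1) unfolding side_def covering_def by blast
  next
    case False
    then show ?thesis using that(2) no unfolding side_def full_def by blast
  qed
qed

lemma laminar_of_outside:
  assumes "j < m" "k < m" "i < n" "\<not> side i j" "\<not> side i k"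
  shows "(\<forall>i<n. side i j \<longrightarrow> side i k) \<or> (\<forall>i<n. side i k \<longrightarrow> side i j)
    \<or> (\<forall>i<n. \<not> (side i j \<and> side i k))"
  using side_compatible[OF assms(1,2)] assms(3-5) by blast

lemma laminar_bounded_base:
  assumes "j < m" "k < m" "l < m" "constrained l" "\<And>i. i < n \<Longrightarrow> side i j \<Longrightarrow> a i l"
    "\<not> contained k l \<and> \<not> covering k l"
  shows "(\<forall>i<n. side i j \<longrightarrow> side i k) \<or> (\<forall>i<n. \<not> (side i j \<and> side i k))"
proof -
  have "(\<forall>i<n. a i l \<longrightarrow> \<not> a i k) \<or> (\<forall>i<n. a i l \<longrightarrow> a i k)"
    using compatible[OF assms(2,3)] assms(6) unfolding contained_def covering_def by blast
  then have "(\<forall>i<n. a i l \<longrightarrow> side i k) \<or> (\<forall>i<n. a i l \<longrightarrow> \<not> side i k)"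
    unfolding side_def by (cases "full k") auto
  then show ?thesis using assms(5) by blast
qed

lemma side_laminar:
  assumes "j < m" "k < m"
  shows "(\<forall>i<n. side i j \<longrightarrow> side i k) \<or> (\<forall>i<n. side i k \<longrightarrow> side i j)
    \<or> (\<forall>i<n. \<not> (side i j \<and> side i k))"
proof (rule side_bounded_or_base[OF assms(1)])
  fix l assume l: "l < m" "constrained l" "\<And>i. i < n \<Longrightarrow> side i j \<Longrightarrow> a i l"
  show ?thesis
  proof (rule side_bounded_or_base[OF assms(2)])
    fix l' assume l': "l' < m" "constrained l'" "\<And>i. i < n \<Longrightarrow> side i k \<Longrightarrow> a i l'"
    obtain i i' where i: "i < n" "\<not> a i l" "i' < n" "\<not> a i' l'"
      using l(1,2) l'(1,2) constraint_zero unfolding constrained_def by blast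
    from constrained_laminar[OF l(1) l'(1) l(2) l'(2)] show ?thesis
    proof (elim disjE)
      assume "contained l l'"
      then have "\<not> side i' j" "\<not> side i' k"
        using i l(3) l'(3) unfolding contained_def by blast+
      then show ?thesis using laminar_of_outside assms i by blast
    next
      assume "contained l' l"
      then have "\<not> side i j" "\<not> side i k"
        using i l(3) l'(3) unfolding contained_def by blast+
      then show ?thesis using laminar_of_outside assms i by blast
    next
      assume "\<not> meeting l l'"
      then show ?thesis using l(3) l'(3) unfolding meeting_def by blast
    qed
  next
    assume "\<And>l. l < m \<Longrightarrow> constrained l \<Longrightarrow> \<not> contained k l \<and> \<not> covering k l"
    from laminar_bounded_base[OF assms l this[OF l(1,2)]] show ?thesis by blast
  qed
next
  assume base: "\<And>l. l < m \<Longrightarrow> constrained l \<Longrightarrow> \<not> contained j l \<and> \<not> covering j l"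
    "0 < n \<Longrightarrow> \<not> side 0 j"
  show ?thesis
  proof (rule side_bounded_or_base[OF assms(2)])
    fix l assume l: "l < m" "constrained l" "\<And>i. i < n \<Longrightarrow> side i k \<Longrightarrow> a i l"
    from laminar_bounded_base[OF assms(2,1) l base(1)[OF l(1,2)]] show ?thesis by blast
  next
    assume "0 < n \<Longrightarrow> \<not> side 0 k"
    then show ?thesis using laminar_of_outside[OF assms, of 0] base(2) by (cases "n = 0") auto
  qed
qed

lemma below_linear_of_side:
  assumes "j < m" "k < m" "i < n" "side i j" "side i k"
  shows "below j k \<or> below k j"
  using side_laminar[OF assms(1,2)] assms(3-5) nat_le_linear[of j k] unfolding below_def by blast

lemma below_linear:
  assumes "k < m" "l < m" "below j k" "below j l"
  shows "below k l \<or> below l k"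
proof (cases "j = k \<or> j = l")
  case True
  then show ?thesis using assms by auto
next
  case False
  then obtain i where "i < n" "side i k" "side i l"
    using assms(3,4) unfolding below_def by blast
  then show ?thesis using below_linear_of_side assms by blast
qed

lemma below_least_exists:
  assumes "A \<subseteq> {..<m}" "A \<noteq> {}" "\<And>j k. j \<in> A \<Longrightarrow> k \<in> A \<Longrightarrow> below j k \<or> below k j"
  obtains k where "k \<in> A" "\<And>l. l \<in> A \<Longrightarrow> below k l"
proof -
  have "finite A" using assms(1) finite_subset by blast
  then have "\<exists>k\<in>A. \<forall>l\<in>A. below k l" using assms(2,3)
  proof (induction A rule: finite_ne_induct)
    case (singleton j)
    then show ?case by (simp add: below_refl)
  next
    case (insert j A)
    then obtain k where k: "k \<in> A" "\<forall>l\<in>A. below k l" by auto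
    have "below j k \<or> below k j" using insert.prems k(1) by blast
    then show ?case
    proof
      assume "below j k"
      then show ?thesis using k below_trans below_refl by (intro bexI[of _ j]) auto
    next
      assume "below k j"
      then show ?thesis using k by blast
    qed
  qed
  then show ?thesis using that by blast
qed

lemma parent_cases:
  assumes "j < m"
  obtains "parent j = m" "\<And>k. k < m \<Longrightarrow> below j k \<Longrightarrow> k = j"
  | "parent j < m" "parent j \<noteq> j" "below j (parent j)"
    "\<And>k. k < m \<Longrightarrow> below j k \<Longrightarrow> k \<noteq> j \<Longrightarrow> below (parent j) k"
proof (cases "\<exists>k<m. k \<noteq> j \<and> below j k")
  case False
  then have "\<not> parent j < m" unfolding parent_def search_less_iff by blast
  moreover have "parent j \<le> m" unfolding parent_def by (rule search_le)
  ultimately have "parent j = m" by simp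
  then show ?thesis using that(1) False by blast
next
  case True
  let ?A = "{k. k < m \<and> k \<noteq> j \<and> below j k}"
  obtain k where "k \<in> ?A" "\<And>l. l \<in> ?A \<Longrightarrow> below k l"
    by (rule below_least_exists[of ?A]) (use True below_linear in auto)
  then have less: "parent j < m" unfolding parent_def search_less_iff by blast
  have "parent j \<noteq> j \<and> below j (parent j) \<and>
      (\<forall>l<m. l \<noteq> j \<and> below j l \<longrightarrow> below (parent j) l)"
    using search_sound[OF less[unfolded parent_def]] unfolding parent_def .
  then show ?thesis using that(2) less by blast
qed

lemma spot_cases:
  assumes "i < n"
  obtains "spot i = m" "\<And>k. k < m \<Longrightarrow> \<not> side i k"
  | "spot i < m" "side i (spot i)" "\<And>k. k < m \<Longrightarrow> side i k \<Longrightarrow> below (spot i) k"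
proof (cases "\<exists>k<m. side i k")
  case False
  then have "\<not> spot i < m" unfolding spot_def search_less_iff by blast
  moreover have "spot i \<le> m" unfolding spot_def by (rule search_le)
  ultimately have "spot i = m" by simp
  then show ?thesis using that(1) False by blast
next
  case True
  let ?A = "{k. k < m \<and> side i k}"
  obtain k where "k \<in> ?A" "\<And>l. l \<in> ?A \<Longrightarrow> below k l"
    by (rule below_least_exists[of ?A]) (use True below_linear_of_side assms in auto)
  then have less: "spot i < m" unfolding spot_def search_less_iff by blast
  have "side i (spot i) \<and> (\<forall>l<m. side i l \<longrightarrow> below (spot i) l)"
    using search_sound[OF less[unfolded spot_def]] unfolding spot_def .
  then show ?thesis using that(2) less by blast
qed

lemma parent_neq: "j < m \<Longrightarrow> parent j \<noteq> j"
  using parent_cases[of j] by force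

lemma parent_le: "parent j \<le> m"
  unfolding parent_def by (rule search_le)

lemma path_below:
  assumes "(k, v) \<in> (arcs tree)\<^sup>*" "k < m"
  shows "v < m \<and> below v k"
  using assms(1)
proof induction
  case base
  then show ?case using assms(2) by (simp add: below_refl)
next
  case (step v w)
  then have "w < m" "v = parent w" by (auto split: if_splits)
  have "below w v"
    by (rule parent_cases[OF \<open>w < m\<close>]) (use step.IH \<open>v = parent w\<close> in simp_all)
  then show ?case using step.IH \<open>w < m\<close> below_trans by blast
qed

lemma below_path_aux:
  "j < m \<Longrightarrow> (m, j) \<in> (arcs tree)\<^sup>* \<and> (\<forall>k<m. below j k \<longrightarrow> (k, j) \<in> (arcs tree)\<^sup>*)"
proof (induction j rule: measure_induct_rule[of "\<lambda>j. card {l. l < m \<and> l \<noteq> j \<and> below j l}"])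
  case (less j)
  let ?U = "\<lambda>j. {l. l < m \<and> l \<noteq> j \<and> below j l}"
  have arc: "(parent j, j) \<in> arcs tree" using less.prems by simp
  show ?case
  proof (rule parent_cases[OF less.prems])
    assume "parent j = m" "\<And>k. k < m \<Longrightarrow> below j k \<Longrightarrow> k = j"
    then show ?thesis using arc by (metis r_into_rtrancl rtrancl.rtrancl_refl)
  next
    assume p: "parent j < m" "parent j \<noteq> j" "below j (parent j)"
      "\<And>k. k < m \<Longrightarrow> below j k \<Longrightarrow> k \<noteq> j \<Longrightarrow> below (parent j) k"
    have "?U (parent j) \<subseteq> ?U j" using p(1-3) below_trans below_antisym by blast
    moreover have "parent j \<in> ?U j" "parent j \<notin> ?U (parent j)" using p by auto
    ultimately have "?U (parent j) \<subset> ?U j" by blast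
    then have "card (?U (parent j)) < card (?U j)" by (intro psubset_card_mono) auto
    from less.IH[OF this p(1)] have IH: "(m, parent j) \<in> (arcs tree)\<^sup>*"
      "\<And>k. k < m \<Longrightarrow> below (parent j) k \<Longrightarrow> (k, parent j) \<in> (arcs tree)\<^sup>*"
      by blast+
    have "(k, j) \<in> (arcs tree)\<^sup>*" if "k < m" "below j k" for k
      using rtrancl_into_rtrancl[OF IH(2)[OF that(1) p(4)[OF that]] arc] by (cases "k = j") auto
    with rtrancl_into_rtrancl[OF IH(1) arc] show ?thesis by blast
  qed
qed

lemma path_iff_below:
  assumes "j < m" "k < m"
  shows "(k, j) \<in> (arcs tree)\<^sup>* \<longleftrightarrow> below j k"
  using below_path_aux[OF assms(1)] path_below[OF _ assms(2)] assms(2) by blast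

lemma top_path: "j < m \<Longrightarrow> (m, j) \<in> (arcs tree)\<^sup>*"
  using below_path_aux by blast

lemma rooted_tree_tree: "rooted_tree (nodes tree) (arcs tree) (root tree)"
proof -
  have "\<exists>!x. (x, y) \<in> arcs tree" if "y \<in> nodes tree - {root tree}" for y
  proof (cases "y < m")
    case True
    then show ?thesis by (intro ex1I[of _ "parent y"]) (auto split: if_splits)
  next
    case False
    with that have "y = m" "some_full" by (auto simp: root_node_def split: if_splits)
    then show ?thesis by (intro ex1I[of _ "Suc m"]) auto
  qed
  moreover have "(root_node, y) \<in> (arcs tree)\<^sup>*" if y: "y \<in> nodes tree" for y
  proof -
    have top: "(root_node, m) \<in> (arcs tree)\<^sup>*" by (auto simp: root_node_def)
    consider "y < m" | "y = m" | "y = root_node" using y by (auto simp: le_less)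
    then show ?thesis using top top_path[of y] by cases (blast intro: rtrancl_trans)+
  qed
  moreover have "(x, root_node) \<notin> arcs tree" for x by (auto simp: root_node_def)
  moreover have "arcs tree \<subseteq> nodes tree \<times> nodes tree"
    using parent_le by (auto simp: root_node_def)
  ultimately show ?thesis unfolding rooted_tree_def by auto
qed

lemma leaf_below:
  assumes "k < m"
  obtains z where "z < m" "leaf tree z" "below z k"
  using assms
proof (induction k arbitrary: thesis
    rule: measure_induct_rule[of "\<lambda>k. card {l. l < m \<and> l \<noteq> k \<and> below l k}"])
  case (less k)
  let ?D = "\<lambda>k. {l. l < m \<and> l \<noteq> k \<and> below l k}"
  show ?case
  proof (cases "leaf tree k")
    case True
    then show ?thesis using less.prems below_refl by blast
  next
    case False
    then obtain w where w: "(k, w) \<in> arcs tree" using less.prems(2) by (auto simp: leaf_def)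
    then have wm: "w < m" "w \<noteq> k" "below w k"
      using less.prems(2) path_below[OF r_into_rtrancl[OF w]] parent_neq[of w]
      by (auto split: if_splits)
    have "?D w \<subseteq> ?D k" using wm below_trans below_antisym by blast
    moreover have "w \<in> ?D k" "w \<notin> ?D w" using wm by auto
    ultimately have "?D w \<subset> ?D k" by blast
    then have "card (?D w) < card (?D k)" by (intro psubset_card_mono) auto
    from less.IH[OF this _ wm(1)] obtain z where "z < m" "leaf tree z" "below z w" by blast
    then show ?thesis using less.prems(1) wm below_trans by blast
  qed
qed

lemma has_state_parent:
  assumes "j < m" "k < m"
  shows "has_state (parent j) k \<noteq> has_state j k \<longleftrightarrow> j = k"
proof (rule parent_cases[OF assms(1)])
  assume "parent j = m" "\<And>k. k < m \<Longrightarrow> below j k \<Longrightarrow> k = j"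
  then show ?thesis using assms below_refl by (auto simp: has_state_def)
next
  assume p: "parent j < m" "parent j \<noteq> j" "below j (parent j)"
    "\<And>k. k < m \<Longrightarrow> below j k \<Longrightarrow> k \<noteq> j \<Longrightarrow> below (parent j) k"
  have "below (parent j) k \<noteq> below j k \<longleftrightarrow> j = k"
  proof (cases "j = k")
    case True
    have "\<not> below (parent j) j" using below_antisym[OF p(3)] p(2) by auto
    then show ?thesis using True below_refl by auto
  next
    case False
    then have "below j k \<Longrightarrow> below (parent j) k" using p(4) assms(2) by auto
    moreover have "below (parent j) k \<Longrightarrow> below j k" by (rule below_trans[OF p(3)])
    ultimately show ?thesis using False by auto
  qed
  then show ?thesis using assms p(1) by (auto simp: has_state_def)
qed

lemma has_state_top: "has_state m k \<longleftrightarrow> full k"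
  by (auto simp: has_state_def)

lemma has_state_above: "\<not> has_state (Suc m) k"
  by (simp add: has_state_def)

lemma change_arcs_tree:
  assumes "k < m"
  shows "change_arcs tree k = {(parent k, k)} \<union> (if full k then {(Suc m, m)} else {})"
proof -
  have mem: "(x, y) \<in> change_arcs tree k \<longleftrightarrow>
      (x, y) \<in> arcs tree \<and> has_state x k \<noteq> has_state y k" for x y
    using assms unfolding change_arcs_def by simp
  show ?thesis
  proof (intro equalityI subrelI)
    fix x y assume "(x, y) \<in> change_arcs tree k"
    then have *: "(x, y) \<in> arcs tree" "has_state x k \<noteq> has_state y k" using mem by blast+
    from *(1) consider "y < m" "x = parent y" | "x = Suc m" "y = m" by (auto split: if_splits)
    then show "(x, y) \<in> {(parent k, k)} \<union> (if full k then {(Suc m, m)} else {})"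
    proof cases
      case 1
      then show ?thesis using has_state_parent[of y k] assms *(2) by simp
    next
      case 2
      then show ?thesis using *(2) by (simp add: has_state_top has_state_above)
    qed
  next
    fix x y assume "(x, y) \<in> {(parent k, k)} \<union> (if full k then {(Suc m, m)} else {})"
    then consider "x = parent k" "y = k" | "full k" "x = Suc m" "y = m"
      by (auto split: if_splits)
    then show "(x, y) \<in> change_arcs tree k"
    proof cases
      case 1
      then show ?thesis using has_state_parent[of k k] assms mem by simp
    next
      case 2
      then have some_full using assms by (auto simp: some_full_def)
      then show ?thesis using 2 mem by (simp add: has_state_top has_state_above)
    qed
  qed
qed

lemma has_state_self: "k < m \<Longrightarrow> has_state k k \<longleftrightarrow> \<not> full k"
  by (auto simp: has_state_def below_refl)

lemma arc_label_nonempty: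
  assumes "j < m" "has_state x j \<noteq> has_state y j"
  shows "arc_label m tree (x, y) \<noteq> {}"
  using assms by (cases "has_state x j") (auto simp: arc_label_def)

lemma change_arcs_order:
  assumes k: "k < m" and ch: "(x, y) \<in> change_arcs tree k" "(u, v) \<in> change_arcs tree k"
    "(x, y) \<noteq> (u, v)"
  shows "\<exists>z. leaf tree z \<and> (x, y) \<in> root_path tree z \<and> (u, v) \<in> root_path tree z"
    and "(y, u) \<in> (arcs tree)\<^sup>* \<Longrightarrow>
      \<not> has_state x k \<and> \<not> has_state v k \<and> has_state y k \<and> has_state u k"
proof -
  have full: "full k" and some_full
    using ch k by (auto simp: change_arcs_tree some_full_def split: if_splits)
  have eq: "(x, y) = (Suc m, m) \<and> (u, v) = (parent k, k) \<or>
      (u, v) = (Suc m, m) \<and> (x, y) = (parent k, k)"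
    using ch k full by (auto simp: change_arcs_tree)
  obtain z where z: "z < m" "leaf tree z" "below z k" by (rule leaf_below[OF k])
  have "(Suc m, m) \<in> root_path tree z" "(parent k, k) \<in> root_path tree z"
    using z k top_path[of z] path_iff_below[of z k] \<open>some_full\<close> unfolding root_path_def by auto
  then show "\<exists>z. leaf tree z \<and> (x, y) \<in> root_path tree z \<and> (u, v) \<in> root_path tree z"
    using z(2) eq by auto
  assume yu: "(y, u) \<in> (arcs tree)\<^sup>*"
  have "\<not> (k, Suc m) \<in> (arcs tree)\<^sup>*" using path_below[OF _ k] by fastforce
  with eq yu have "(x, y) = (Suc m, m)" "(u, v) = (parent k, k)" by auto
  then show "\<not> has_state x k \<and> \<not> has_state v k \<and> has_state y k \<and> has_state u k"
    using full has_state_self[OF k] has_state_parent[OF k k] has_state_top has_state_above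
    by simp
qed

lemma has_state_spot:
  assumes "i < n" "k < m"
  shows "has_state (spot i) k \<longleftrightarrow> a i k"
proof -
  have "(spot i < m \<and> below (spot i) k) \<longleftrightarrow> side i k"
  proof (rule spot_cases[OF assms(1)])
    assume "spot i < m" "side i (spot i)" "\<And>k. k < m \<Longrightarrow> side i k \<Longrightarrow> below (spot i) k"
    then show ?thesis using assms side_below by blast
  qed (use assms in auto)
  moreover have "spot i \<le> m" unfolding spot_def by (rule search_le)
  ultimately show ?thesis unfolding has_state_def side_def by auto
qed

lemma tree_persistent_perfect_phylogeny:
  assumes dim: "dim_row M = n" "dim_col M = m"
    and entry: "\<And>i j. i < n \<Longrightarrow> j < m \<Longrightarrow> a i j \<longleftrightarrow> M $$ (i, j) = 1"
  shows "persistent_perfect_phylogeny M tree"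
  unfolding persistent_perfect_phylogeny_def dim
proof (intro conjI ballI allI impI)
  show "rooted_tree (nodes tree) (arcs tree) (root tree)" by (rule rooted_tree_tree)
  show "state tree x \<in> carrier_vec m" for x by simp
  have "\<not> has_state root_node k" if "k < m" for k
    using that by (auto simp: root_node_def has_state_def some_full_def)
  then show "state tree (root tree) = 0\<^sub>v m" by auto
  show "arc_label m tree z \<noteq> {}" if z: "z \<in> arcs tree" for z
  proof -
    consider j where "j < m" "z = (parent j, j)" | "some_full" "z = (Suc m, m)"
      using z by (auto split: if_splits)
    then show ?thesis
    proof cases
      case 1
      then show ?thesis using arc_label_nonempty has_state_parent by blast
    next
      case 2
      then obtain j where "j < m" "full j" by (auto simp: some_full_def)
      then show ?thesis using 2 arc_label_nonempty[of j "Suc m" m] by (auto simp: has_state_def)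
    qed
  qed
  show "place tree i \<in> nodes tree" for i
    unfolding spot_def tree_sel using search_le by auto
  show "state tree (place tree i) = row M i" if "i < n" for i
    using that dim entry[OF that] has_state_spot[OF that]
    by (intro eq_vecI) (auto simp: of_bool_def)
  fix k assume k: "k < m"
  show "card (change_arcs tree k) \<le> 2"
    using k by (simp add: change_arcs_tree card_insert_if)
  fix x y u v
  assume ch: "(x, y) \<in> change_arcs tree k \<and> (u, v) \<in> change_arcs tree k \<and> (x, y) \<noteq> (u, v)"
  note order = change_arcs_order[OF k, of x y u v]
  show "\<exists>z. leaf tree z \<and> (x, y) \<in> root_path tree z \<and> (u, v) \<in> root_path tree z"
    using order(1) ch by blast
  assume "(y, u) \<in> (arcs tree)\<^sup>*"
  then have "\<not> has_state x k \<and> \<not> has_state v k \<and> has_state y k \<and> has_state u k"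
    using order(2) ch by blast
  then show "state tree x $ k = 0" "state tree v $ k = 0" "state tree y $ k = 1"
    "state tree u $ k = 1"
    using k by auto
qed

lemma tree_consistent_with:
  assumes "Es \<subseteq> {(i, j). i < n \<and> j < m \<and> e i j}"
  shows "consistent_with tree Es"
  unfolding consistent_with_def
proof clarify
  fix i j assume "(i, j) \<in> Es"
  then have ij: "i < n" "j < m" "e i j" using assms by auto
  then have nf: "\<not> full j" using not_full_if_constrained[of j] by (auto simp: constrained_def)
  then have "\<not> side i j" using constraint_zero[OF ij] by (simp add: side_def)
  then have "(j, spot i) \<notin> (arcs tree)\<^sup>*"
    using has_state_spot[OF ij(1,2)] nf path_below[of j "spot i"] ij(2)
    by (auto simp: has_state_def side_def)
  then show "root_path tree (place tree i) \<inter> change_arcs tree j = {}"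
    using nf ij by (auto simp: change_arcs_tree root_path_def)
qed

end

section \<open>Necessity of feasibility\<close>

lemma rtrancl_tree_comparable:
  assumes uniq: "\<And>x x' y. (x, y) \<in> E \<Longrightarrow> (x', y) \<in> E \<Longrightarrow> x = x'"
    and "(x, z) \<in> E\<^sup>*" "(y, z) \<in> E\<^sup>*"
  shows "(x, y) \<in> E\<^sup>* \<or> (y, x) \<in> E\<^sup>*"
  using assms(2,3)
proof (induction arbitrary: y)
  case base
  then show ?case by blast
next
  case (step w z)
  note arc = step.hyps and IH = step.IH
  from step.prems show ?case
  proof (cases rule: rtranclE)
    case base
    then show ?thesis using arc by auto
  next
    case (step v)
    then show ?thesis using uniq[OF arc(2)] IH by blast
  qed
qed

lemma rooted_tree_parent_unique:
  assumes "rooted_tree V E r" "(x, y) \<in> E" "(x', y) \<in> E"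
  shows "x = x'"
  using assms unfolding rooted_tree_def by blast

context
  fixes M :: "bit mat" and T :: "('v, 'b) phylogeny_scheme"
  assumes ppp: "persistent_perfect_phylogeny M T"
begin

lemma ppp_tree: "rooted_tree (nodes T) (arcs T) (root T)"
  using ppp unfolding persistent_perfect_phylogeny_def by blast

lemma ppp_comparable:
  "(x, z) \<in> (arcs T)\<^sup>* \<Longrightarrow> (y, z) \<in> (arcs T)\<^sup>* \<Longrightarrow> (x, y) \<in> (arcs T)\<^sup>* \<or> (y, x) \<in> (arcs T)\<^sup>*"
  using rtrancl_tree_comparable rooted_tree_parent_unique[OF ppp_tree] by metis

lemma ppp_gain_order:
  assumes j: "j < dim_col M"
    and 1: "(x, y) \<in> arcs T" "state T x $ j = 0" "state T y $ j = 1"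
    and 2: "(u, v) \<in> arcs T" "state T u $ j = 0" "state T v $ j = 1"
    and yv: "(y, v) \<in> (arcs T)\<^sup>*"
  shows "y = v"
proof (rule ccontr)
  assume "y \<noteq> v"
  from yv obtain w where "(y, w) \<in> (arcs T)\<^sup>*" "(w, v) \<in> arcs T"
    by (cases rule: rtranclE) (use \<open>y \<noteq> v\<close> in auto)
  then have "(y, u) \<in> (arcs T)\<^sup>*"
    using rooted_tree_parent_unique[OF ppp_tree 2(1)] by blast
  moreover have "(x, y) \<in> change_arcs T j" "(u, v) \<in> change_arcs T j"
    using 1 2 by (auto simp: change_arcs_def)
  ultimately have "state T v $ j = 0"
    using ppp j \<open>y \<noteq> v\<close> unfolding persistent_perfect_phylogeny_def by blast
  then show False using 2 by simp
qed

lemma ppp_gain_unique: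
  assumes j: "j < dim_col M"
    and 1: "(x, y) \<in> arcs T" "state T x $ j = 0" "state T y $ j = 1"
    and 2: "(u, v) \<in> arcs T" "state T u $ j = 0" "state T v $ j = 1"
  shows "y = v"
proof (rule ccontr)
  assume "y \<noteq> v"
  moreover have "(x, y) \<in> change_arcs T j" "(u, v) \<in> change_arcs T j"
    using 1 2 by (auto simp: change_arcs_def)
  ultimately obtain z where "(x, y) \<in> root_path T z" "(u, v) \<in> root_path T z"
    using ppp j unfolding persistent_perfect_phylogeny_def by blast
  then have "(y, v) \<in> (arcs T)\<^sup>* \<or> (v, y) \<in> (arcs T)\<^sup>*"
    using ppp_comparable by (auto simp: root_path_def)
  then show False using ppp_gain_order[OF j 1 2] ppp_gain_order[OF j 2 1] \<open>y \<noteq> v\<close> by blast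
qed

lemma ppp_gain_exists:
  assumes "(root T, z) \<in> (arcs T)\<^sup>*" "j < dim_col M" "state T z $ j = 1"
  shows "\<exists>x y. (x, y) \<in> arcs T \<and> state T x $ j = 0 \<and> state T y $ j = 1 \<and> (y, z) \<in> (arcs T)\<^sup>*"
  using assms(1,3)
proof induction
  case base
  have "state T (root T) = 0\<^sub>v (dim_col M)"
    using ppp unfolding persistent_perfect_phylogeny_def by blast
  then show ?case using base assms(2) by simp
next
  case (step w z)
  show ?case
  proof (cases "state T w $ j = 1")
    case True
    then show ?thesis using step by (meson rtrancl.rtrancl_into_rtrancl)
  next
    case False
    then have "state T w $ j = 0" by simp
    then show ?thesis using step by blast
  qed
qed

lemma ppp_place_root_path:
  assumes "i < dim_row M"
  shows "(root T, place T i) \<in> (arcs T)\<^sup>*"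
proof -
  have "place T i \<in> nodes T"
    using ppp assms unfolding persistent_perfect_phylogeny_def by blast
  then show ?thesis using ppp_tree unfolding rooted_tree_def by blast
qed

lemma ppp_place_state:
  assumes "i < dim_row M" "j < dim_col M"
  shows "state T (place T i) $ j = M $$ (i, j)"
  using ppp assms unfolding persistent_perfect_phylogeny_def by simp

lemma ppp_gain_arc:
  assumes "j < dim_col M" "p < dim_row M" "M $$ (p, j) = 1"
  obtains x y where "(x, y) \<in> change_arcs T j"
    "\<And>i. i < dim_row M \<Longrightarrow> M $$ (i, j) = 1 \<Longrightarrow> (y, place T i) \<in> (arcs T)\<^sup>*"
proof -
  have gain: "\<exists>x y. (x, y) \<in> arcs T \<and> state T x $ j = 0 \<and> state T y $ j = 1 \<and>
      (y, place T i) \<in> (arcs T)\<^sup>*" if "i < dim_row M" "M $$ (i, j) = 1" for i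
    using ppp_gain_exists[OF ppp_place_root_path[OF that(1)] assms(1)]
      ppp_place_state[OF that(1) assms(1)] that(2) by simp
  from gain[OF assms(2,3)] obtain x y
    where xy: "(x, y) \<in> arcs T" "state T x $ j = 0" "state T y $ j = 1" by blast
  show ?thesis
  proof (rule that)
    show "(x, y) \<in> change_arcs T j" using xy by (simp add: change_arcs_def)
    show "(y, place T i) \<in> (arcs T)\<^sup>*" if "i < dim_row M" "M $$ (i, j) = 1" for i
      using gain[OF that] ppp_gain_unique[OF assms(1) xy] by blast
  qed
qed

lemma ppp_not_covering:
  assumes cons: "consistent_with T Es"
    and jk: "j < dim_col M" "k < dim_col M"
    and p: "p < dim_row M" "M $$ (p, j) = 1" "M $$ (p, k) = 1"
    and r: "(r, j) \<in> Es" "r < dim_row M" "M $$ (r, k) = 1"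
    and s: "(s, k) \<in> Es" "s < dim_row M" "M $$ (s, j) = 1"
  shows False
proof -
  obtain x y where xy: "(x, y) \<in> change_arcs T j"
    "\<And>i. i < dim_row M \<Longrightarrow> M $$ (i, j) = 1 \<Longrightarrow> (y, place T i) \<in> (arcs T)\<^sup>*"
    using ppp_gain_arc[OF jk(1) p(1,2)] by blast
  obtain u v where uv: "(u, v) \<in> change_arcs T k"
    "\<And>i. i < dim_row M \<Longrightarrow> M $$ (i, k) = 1 \<Longrightarrow> (v, place T i) \<in> (arcs T)\<^sup>*"
    using ppp_gain_arc[OF jk(2) p(1,3)] by blast
  have outside: "(b, place T i) \<notin> (arcs T)\<^sup>*"
    if "(i, l) \<in> Es" "(a, b) \<in> change_arcs T l" for a b i l
  proof
    assume "(b, place T i) \<in> (arcs T)\<^sup>*"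
    then have "(a, b) \<in> root_path T (place T i) \<inter> change_arcs T l"
      using that(2) by (auto simp: root_path_def change_arcs_def)
    then show False using cons that(1) unfolding consistent_with_def by fast
  qed
  have "(y, v) \<in> (arcs T)\<^sup>* \<or> (v, y) \<in> (arcs T)\<^sup>*"
    using ppp_comparable[OF xy(2) uv(2)] p by blast
  then show False
    using outside[OF r(1) xy(1)] outside[OF s(1) uv(1)] uv(2)[OF r(2,3)] xy(2)[OF s(2,3)]
    by (meson rtrancl_trans)
qed

end

section \<open>The algorithm\<close>

lemma enc_list_map: "enc_list f (map g xs) = enc_list (\<lambda>x. f (g x)) xs"
  by (induction xs) auto

lemma enc_vec_vec: "enc_vec (vec d f) = enc_list (\<lambda>k. enc_bit (f k)) [0..<d]"
  by (simp add: enc_vec_def list_of_vec_vec enc_list_map)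

context character_table
begin

definition node_code :: "nat \<Rightarrow> dat" where
  "node_code v =
     Dot (enc_nat v) (enc_list (\<lambda>k. if has_state v k then Dot Atom Atom else Atom) [0..<m])"

definition arc_codes :: dat where
  "arc_codes = enc_list (\<lambda>j. Dot (enc_nat (parent j)) (enc_nat j)) [0..<m]"

definition answer :: dat where
  "answer =
     (if feasible then
        Dot (enc_nat root_node)
          (Dot (Dot (node_code root_node) (Dot (node_code m) (enc_list node_code [0..<m])))
            (Dot (if some_full then Dot (Dot (enc_nat (Suc m)) (enc_nat m)) arc_codes
                  else arc_codes)
              (enc_list (\<lambda>i. enc_nat (spot i)) [0..<n])))
      else Atom)"

lemma answer_reports_tree:
  assumes feasible
  shows "reports_phylogeny n answer tree"
  unfolding reports_phylogeny_def
proof (intro exI conjI)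
  let ?es = "(if some_full then [(Suc m, m)] else []) @ map (\<lambda>j. (parent j, j)) [0..<m]"
  show "set (root_node # m # [0..<m]) = nodes tree" by auto
  show "set ?es = arcs tree" by auto
  have "Dot (enc_nat v) (enc_vec (state tree v)) = node_code v" for v
    by (simp add: node_code_def enc_vec_vec enc_bit_def of_bool_def if_distrib cong: if_cong)
  then show "answer = enc_phylogeny n (root_node # m # [0..<m]) ?es tree"
    using assms
    by (simp add: answer_def enc_phylogeny_def arc_codes_def enc_list_map del: tree_sel(4))
qed

end

definition entry :: "dat \<Rightarrow> nat \<Rightarrow> nat \<Rightarrow> bool" where
  "entry d i j \<longleftrightarrow> head ((tail ^^ j) (head ((tail ^^ i) d))) \<noteq> Atom"

definition instance_rows :: "dat \<Rightarrow> nat" where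
  "instance_rows d = dec_nat (head d)"

definition instance_cols :: "dat \<Rightarrow> nat" where
  "instance_cols d = dec_nat (head (tail d))"

definition instance_matrix :: "dat \<Rightarrow> nat \<Rightarrow> nat \<Rightarrow> bool" where
  "instance_matrix d = entry (head (tail (tail d)))"

definition instance_constraints :: "dat \<Rightarrow> nat \<Rightarrow> nat \<Rightarrow> bool" where
  "instance_constraints d = entry (tail (tail (tail d)))"

lemma pdec_entry:
  assumes "ptime d" "pnat i" "pnat j"
  shows "pdec (\<lambda>x. entry (d x) (i x) (j x))"
  unfolding entry_def
  by (intro pdec_not_Atom ptime_head ptime_funpow_tail assms)

context
  fixes X :: "dat \<Rightarrow> dat"
  assumes X: "ptime X"
begin

lemma pnat_instance_rows: "pnat (\<lambda>x. instance_rows (X x))"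
  unfolding instance_rows_def by (intro ptime_intros X)

lemma pnat_instance_cols: "pnat (\<lambda>x. instance_cols (X x))"
  unfolding instance_cols_def by (intro ptime_intros X)

lemma pdec_instance_matrix:
  "pnat i \<Longrightarrow> pnat j \<Longrightarrow> pdec (\<lambda>x. instance_matrix (X x) (i x) (j x))"
  unfolding instance_matrix_def by (intro ptime_intros X pdec_entry)

lemma pdec_instance_constraints:
  "pnat i \<Longrightarrow> pnat j \<Longrightarrow> pdec (\<lambda>x. instance_constraints (X x) (i x) (j x))"
  unfolding instance_constraints_def by (intro ptime_intros X pdec_entry)

end

lemmas instance_intros = ptime_intros
  pnat_instance_rows pnat_instance_cols pdec_instance_matrix pdec_instance_constraints

lemma pdec_constrained:
  assumes X: "ptime X" and k: "pnat k"
  shows "pdec (\<lambda>x. character_table.constrained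
    (instance_rows (X x)) (instance_constraints (X x)) (k x))"
  unfolding character_table.constrained_def
  by (intro instance_intros ptime_comp[OF X] pnat_comp[OF k])

lemma pdec_contained:
  assumes X: "ptime X" and j: "pnat j" and k: "pnat k"
  shows "pdec (\<lambda>x. character_table.contained
    (instance_rows (X x)) (instance_matrix (X x)) (j x) (k x))"
  unfolding character_table.contained_def
  by (intro instance_intros ptime_comp[OF X] pnat_comp[OF j] pnat_comp[OF k])

lemma pdec_covering:
  assumes X: "ptime X" and j: "pnat j" and k: "pnat k"
  shows "pdec (\<lambda>x. character_table.covering
    (instance_rows (X x)) (instance_matrix (X x)) (j x) (k x))"
  unfolding character_table.covering_def
  by (intro instance_intros ptime_comp[OF X] pnat_comp[OF j] pnat_comp[OF k])

lemma pdec_meeting: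
  assumes X: "ptime X" and j: "pnat j" and k: "pnat k"
  shows "pdec (\<lambda>x. character_table.meeting
    (instance_rows (X x)) (instance_matrix (X x)) (j x) (k x))"
  unfolding character_table.meeting_def
  by (intro instance_intros ptime_comp[OF X] pnat_comp[OF j] pnat_comp[OF k])

lemma pdec_feasible:
  assumes X: "ptime X"
  shows "pdec (\<lambda>x. character_table.feasible (instance_rows (X x)) (instance_cols (X x))
    (instance_matrix (X x)) (instance_constraints (X x)))"
  unfolding character_table.feasible_def
  by (intro instance_intros pdec_constrained pdec_covering pdec_meeting ptime_comp[OF X])

lemma pdec_full:
  assumes X: "ptime X" and j: "pnat j"
  shows "pdec (\<lambda>x. character_table.full (instance_rows (X x)) (instance_cols (X x))
    (instance_matrix (X x)) (instance_constraints (X x)) (j x))"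
  unfolding character_table.full_def
  by (intro instance_intros pdec_constrained pdec_contained pdec_covering ptime_comp[OF X]
      pnat_comp[OF j])

lemma pdec_some_full:
  assumes X: "ptime X"
  shows "pdec (\<lambda>x. character_table.some_full (instance_rows (X x)) (instance_cols (X x))
    (instance_matrix (X x)) (instance_constraints (X x)))"
  unfolding character_table.some_full_def by (intro instance_intros pdec_full ptime_comp[OF X])

lemma pnat_root_node:
  assumes X: "ptime X"
  shows "pnat (\<lambda>x. character_table.root_node (instance_rows (X x)) (instance_cols (X x))
    (instance_matrix (X x)) (instance_constraints (X x)))"
  unfolding character_table.root_node_def by (intro instance_intros pdec_some_full X)

lemma pdec_side:
  assumes X: "ptime X" and i: "pnat i" and j: "pnat j"
  shows "pdec (\<lambda>x. character_table.side (instance_rows (X x)) (instance_cols (X x))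
    (instance_matrix (X x)) (instance_constraints (X x)) (i x) (j x))"
  unfolding character_table.side_def by (intro instance_intros pdec_full X i j)

lemma pdec_below:
  assumes X: "ptime X" and j: "pnat j" and k: "pnat k"
  shows "pdec (\<lambda>x. character_table.below (instance_rows (X x)) (instance_cols (X x))
    (instance_matrix (X x)) (instance_constraints (X x)) (j x) (k x))"
  unfolding character_table.below_def
  by (intro instance_intros pdec_side ptime_comp[OF X] pnat_comp[OF j] pnat_comp[OF k])

lemma pnat_parent:
  assumes X: "ptime X" and j: "pnat j"
  shows "pnat (\<lambda>x. character_table.parent (instance_rows (X x)) (instance_cols (X x))
    (instance_matrix (X x)) (instance_constraints (X x)) (j x))"
  unfolding character_table.parent_def
  by (intro instance_intros pdec_below ptime_comp[OF X] pnat_comp[OF j])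

lemma pnat_spot:
  assumes X: "ptime X" and i: "pnat i"
  shows "pnat (\<lambda>x. character_table.spot (instance_rows (X x)) (instance_cols (X x))
    (instance_matrix (X x)) (instance_constraints (X x)) (i x))"
  unfolding character_table.spot_def
  by (intro instance_intros pdec_side pdec_below ptime_comp[OF X] pnat_comp[OF i])

lemma pdec_has_state:
  assumes X: "ptime X" and v: "pnat v" and k: "pnat k"
  shows "pdec (\<lambda>x. character_table.has_state (instance_rows (X x)) (instance_cols (X x))
    (instance_matrix (X x)) (instance_constraints (X x)) (v x) (k x))"
  unfolding character_table.has_state_def
  by (intro instance_intros pdec_full pdec_below X v k)

lemma ptime_node_code:
  assumes X: "ptime X" and v: "pnat v"
  shows "ptime (\<lambda>x. character_table.node_code (instance_rows (X x)) (instance_cols (X x))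
    (instance_matrix (X x)) (instance_constraints (X x)) (v x))"
  unfolding character_table.node_code_def
  by (intro instance_intros pdec_has_state ptime_comp[OF X] pnat_comp[OF v])

lemma ptime_arc_codes:
  assumes X: "ptime X"
  shows "ptime (\<lambda>x. character_table.arc_codes (instance_rows (X x)) (instance_cols (X x))
    (instance_matrix (X x)) (instance_constraints (X x)))"
  unfolding character_table.arc_codes_def
  by (intro instance_intros pnat_parent ptime_comp[OF X])

lemma ptime_answer:
  "ptime (\<lambda>x. character_table.answer (instance_rows x) (instance_cols x)
    (instance_matrix x) (instance_constraints x))"
  unfolding character_table.answer_def
  by (intro instance_intros pdec_feasible pnat_root_node ptime_node_code pdec_some_full
      ptime_arc_codes pnat_spot)

lemma head_funpow_tail_enc_list:
  "i < length xs \<Longrightarrow> head ((tail ^^ i) (enc_list f xs)) = f (xs ! i)"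
proof (induction xs arbitrary: i)
  case (Cons x xs)
  then show ?case by (cases i) (auto simp: funpow_swap1)
qed simp

lemma entry_enc_mat:
  assumes "i < dim_row A" "j < dim_col A"
  shows "entry (enc_mat A) i j \<longleftrightarrow> A $$ (i, j) = 1"
  using assms
  by (simp add: entry_def enc_mat_def enc_vec_def head_funpow_tail_enc_list list_of_vec_index
      enc_bit_def)

lemma size_enc_list_le:
  assumes "\<And>x. x \<in> set xs \<Longrightarrow> size (f x) \<le> c"
  shows "size (enc_list f xs) \<le> length xs * (c + 1)"
  using assms by (induction xs) (auto simp: add_mono add.commute add.left_commute)

lemma size_enc_mat_le: "size (enc_mat A) \<le> dim_row A * (dim_col A * 2 + 1)"
proof -
  have "size (enc_vec v) \<le> dim_vec v * 2" for v
  proof -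
    have "size (enc_bit b) \<le> 1" for b by (simp add: enc_bit_def)
    from size_enc_list_le[of "list_of_vec v", OF this] show ?thesis
      by (simp add: enc_vec_def mult_2_right)
  qed
  moreover have "dim_vec v = dim_col A" if "v \<in> set (rows A)" for v
    using that by (auto simp: rows_def)
  ultimately have "size (enc_vec v) \<le> dim_col A * 2" if "v \<in> set (rows A)" for v
    using that by metis
  from size_enc_list_le[of "rows A", OF this] show ?thesis by (simp add: enc_mat_def)
qed

lemma size_enc_instance_le: "size (enc_instance M Es) + 2 \<le> 5 + 4 * mat_size M"
proof -
  let ?A = "mat (dim_row M) (dim_col M) (\<lambda>e. if e \<in> Es then 1 else 0) :: bit mat"
  have "size (enc_instance M Es) = dim_row M + dim_col M + size (enc_mat M) + size (enc_mat ?A) + 3"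
    by (simp add: enc_instance_def)
  then show ?thesis
    using size_enc_mat_le[of M] size_enc_mat_le[of ?A]
    by (simp add: mat_size_def algebra_simps)
qed

lemma no_conflict_compatible:
  assumes "conflict_edges M = {}" "j < dim_col M" "k < dim_col M"
  shows "\<not> ((\<exists>i<dim_row M. M $$ (i, j) = 1 \<and> M $$ (i, k) = 1) \<and>
    (\<exists>i<dim_row M. M $$ (i, j) = 1 \<and> M $$ (i, k) \<noteq> 1) \<and>
    (\<exists>i<dim_row M. M $$ (i, j) \<noteq> 1 \<and> M $$ (i, k) = 1) \<and>
    (\<exists>i<dim_row M. M $$ (i, j) \<noteq> 1 \<and> M $$ (i, k) \<noteq> 1))"
proof -
  have "\<not> conflicting M j k" using assms unfolding conflict_edges_def by blast
  moreover have "{(M $$ (s, j), M $$ (s, k)) | s. s < dim_row M} \<subseteq> {(0, 0), (0, 1), (1, 0), (1, 1)}"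
    by auto
  ultimately have "\<not> {(0, 0), (0, 1), (1, 0), (1, 1)} \<subseteq>
      {(M $$ (s, j), M $$ (s, k)) | s. s < dim_row M}"
    unfolding conflicting_def by blast
  then show ?thesis by force
qed

lemma instance_facts:
  fixes M :: "bit mat" and Es :: "(nat \<times> nat) set"
  defines "X \<equiv> enc_instance M Es"
  assumes "constrained_matrix M Es"
  shows "instance_rows X = dim_row M" "instance_cols X = dim_col M"
    "i < dim_row M \<Longrightarrow> j < dim_col M \<Longrightarrow> instance_matrix X i j \<longleftrightarrow> M $$ (i, j) = 1"
    "i < dim_row M \<Longrightarrow> j < dim_col M \<Longrightarrow> instance_constraints X i j \<longleftrightarrow> (i, j) \<in> Es"
    "(i, j) \<in> Es \<Longrightarrow> i < dim_row M \<and> j < dim_col M \<and> M $$ (i, j) = 0"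
  using assms(2)
  by (auto simp: X_def enc_instance_def instance_rows_def instance_cols_def instance_matrix_def
      instance_constraints_def entry_enc_mat constrained_matrix_def)

lemma feasible_tree:
  fixes M :: "bit mat"
  assumes cm: "constrained_matrix M Es" and "conflict_edges M = {}"
    and X: "X = enc_instance M Es"
    and feas: "character_table.feasible (instance_rows X) (instance_cols X)
      (instance_matrix X) (instance_constraints X)"
  defines "T \<equiv> character_table.tree (instance_rows X) (instance_cols X)
      (instance_matrix X) (instance_constraints X)"
  shows "persistent_perfect_phylogeny M T" "consistent_with T Es"
proof -
  note facts = instance_facts[OF cm, folded X]
  interpret feasible_table "instance_rows X" "instance_cols X" "instance_matrix X"
    "instance_constraints X"
  proof
    show "\<not> ((\<exists>i<instance_rows X. instance_matrix X i j \<and> instance_matrix X i k) \<and>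
        (\<exists>i<instance_rows X. instance_matrix X i j \<and> \<not> instance_matrix X i k) \<and>
        (\<exists>i<instance_rows X. \<not> instance_matrix X i j \<and> instance_matrix X i k) \<and>
        (\<exists>i<instance_rows X. \<not> instance_matrix X i j \<and> \<not> instance_matrix X i k))"
      if "j < instance_cols X" "k < instance_cols X" for j k
      using no_conflict_compatible[OF assms(2), of j k] that facts by (simp cong: conj_cong)
  qed (use feas facts in auto)
  show "persistent_perfect_phylogeny M T"
    unfolding T_def by (rule tree_persistent_perfect_phylogeny) (use facts in auto)
  show "consistent_with T Es"
    unfolding T_def by (rule tree_consistent_with) (use facts in auto)
qed

lemma infeasible_no_phylogeny:
  fixes M :: "bit mat"
  assumes cm: "constrained_matrix M Es" and X: "X = enc_instance M Es"
    and "\<not> character_table.feasible (instance_rows X) (instance_cols X)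
      (instance_matrix X) (instance_constraints X)"
    and T: "persistent_perfect_phylogeny M T" "consistent_with T Es"
  shows False
proof -
  note facts = instance_facts[OF cm, folded X]
  interpret character_table "instance_rows X" "instance_cols X" "instance_matrix X"
    "instance_constraints X" .
  obtain j k where jk: "j < dim_col M" "k < dim_col M" "constrained j" "constrained k"
    "covering j k" "meeting j k"
    using assms(3) facts(2) unfolding feasible_def by auto
  obtain p where p: "p < dim_row M" "M $$ (p, j) = 1" "M $$ (p, k) = 1"
    using jk facts unfolding meeting_def by auto
  have cover: "M $$ (i, j) = 1 \<or> M $$ (i, k) = 1" if "i < dim_row M" for i
    using jk facts that unfolding covering_def by auto
  obtain r where r: "(r, j) \<in> Es" "r < dim_row M"
    using jk facts(1,4) unfolding constrained_def by auto
  obtain s where s: "(s, k) \<in> Es" "s < dim_row M"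
    using jk facts(1,4) unfolding constrained_def by auto
  have "M $$ (r, k) = 1" "M $$ (s, j) = 1"
    using facts(5)[OF r(1)] facts(5)[OF s(1)] cover[OF r(2)] cover[OF s(2)] by auto
  then show False
    using ppp_not_covering[OF T jk(1,2) p r] s by blast
qed

lemma ptime_program:
  assumes "ptime f"
  obtains P k where "\<And>x. \<exists>t. computes_in_time P x (f x) t \<and> t \<le> 2 * (size x + 2) ^ k"
proof -
  from assms obtain P e k where r: "realises P e k f" unfolding ptime_def by blast
  let ?P = "shift 1 e # map (shift 1) P"
  have "\<exists>t. computes_in_time ?P x (f x) t \<and> t \<le> 2 * (size x + 2) ^ k" for x
  proof -
    obtain t where t: "eval P e x (f x) t" "t \<le> (size x + 2) ^ k"
        "size (f x) + 2 \<le> (size x + 2) ^ k"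
      by (rule realisesE[OF r])
    have "eval ?P (?P ! 0) x (f x) t" using eval_shift[OF t(1), of "[shift 1 e]"] by simp
    then have "computes_in_time ?P x (f x) (t + size (f x))"
      unfolding computes_in_time_def by blast
    moreover have "t + size (f x) \<le> 2 * (size x + 2) ^ k" using t by linarith
    ultimately show ?thesis by blast
  qed
  then show ?thesis by (rule that)
qed

theorem theorem4:
  shows
    "(\<exists>(P :: program) (q :: nat poly). \<forall>(M :: bit mat) (Es :: (nat \<times> nat) set).
        constrained_matrix M Es \<and> conflict_edges M = {} \<longrightarrow>
        (\<exists>d t. computes_in_time P (enc_instance M Es) d t \<and> t \<le> poly q (mat_size M) \<and>
           (if \<exists>T :: nat phylogeny. persistent_perfect_phylogeny M T \<and> consistent_with T Es
            then \<exists>T :: nat phylogeny. persistent_perfect_phylogeny M T \<and> consistent_with T Es \<and>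
                   reports_phylogeny (dim_row M) d T
            else reports_none d)))
     \<and> (\<forall>M :: bit mat. conflict_edges M = {} \<longrightarrow>
          (\<exists>T :: nat phylogeny. persistent_perfect_phylogeny M T))"
proof (intro conjI allI impI)
  obtain P k where P: "\<And>x. \<exists>t. computes_in_time P x
      (character_table.answer (instance_rows x) (instance_cols x)
        (instance_matrix x) (instance_constraints x)) t \<and> t \<le> 2 * (size x + 2) ^ k"
    using ptime_program[OF ptime_answer] by blast
  show "\<exists>(P :: program) (q :: nat poly). \<forall>(M :: bit mat) (Es :: (nat \<times> nat) set).
        constrained_matrix M Es \<and> conflict_edges M = {} \<longrightarrow>
        (\<exists>d t. computes_in_time P (enc_instance M Es) d t \<and> t \<le> poly q (mat_size M) \<and>
           (if \<exists>T :: nat phylogeny. persistent_perfect_phylogeny M T \<and> consistent_with T Es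
            then \<exists>T :: nat phylogeny. persistent_perfect_phylogeny M T \<and> consistent_with T Es \<and>
                   reports_phylogeny (dim_row M) d T
            else reports_none d))"
  proof (rule exI[of _ P], rule exI[of _ "[:2:] * [:5, 4:] ^ k"], intro allI impI, elim conjE)
    fix M :: "bit mat" and Es :: "(nat \<times> nat) set"
    assume cm: "constrained_matrix M Es" and nc: "conflict_edges M = {}"
    define X where "X = enc_instance M Es"
    interpret character_table "instance_rows X" "instance_cols X" "instance_matrix X"
      "instance_constraints X" .
    obtain t where t: "computes_in_time P X answer t" "t \<le> 2 * (size X + 2) ^ k"
      using P by blast
    have "(size X + 2) ^ k \<le> (5 + 4 * mat_size M) ^ k"
      unfolding X_def by (rule power_mono[OF size_enc_instance_le]) simp
    then have "t \<le> poly ([:2:] * [:5, 4:] ^ k) (mat_size M)"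
      using t(2) by (simp add: poly_power mult.commute)
    moreover have "if \<exists>T :: nat phylogeny. persistent_perfect_phylogeny M T \<and> consistent_with T Es
            then \<exists>T :: nat phylogeny. persistent_perfect_phylogeny M T \<and> consistent_with T Es \<and>
                   reports_phylogeny (dim_row M) answer T
            else reports_none answer"
    proof (cases feasible)
      case True
      from feasible_tree[OF cm nc X_def True] answer_reports_tree[OF True]
        instance_facts(1)[OF cm, folded X_def]
      show ?thesis by (metis (no_types, lifting))
    next
      case False
      then have "reports_none answer" by (simp add: answer_def reports_none_def)
      then show ?thesis using infeasible_no_phylogeny[OF cm X_def False] by auto
    qed
    ultimately show "\<exists>d t. computes_in_time P (enc_instance M Es) d t \<and>
           t \<le> poly ([:2:] * [:5, 4:] ^ k) (mat_size M) \<and>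
           (if \<exists>T :: nat phylogeny. persistent_perfect_phylogeny M T \<and> consistent_with T Es
            then \<exists>T :: nat phylogeny. persistent_perfect_phylogeny M T \<and> consistent_with T Es \<and>
                   reports_phylogeny (dim_row M) d T
            else reports_none d)"
      using t(1) unfolding X_def by blast
  qed
next
  fix M :: "bit mat" assume nc: "conflict_edges M = {}"
  define X where "X = enc_instance M {}"
  have cm: "constrained_matrix M {}" by (simp add: constrained_matrix_def)
  interpret character_table "instance_rows X" "instance_cols X" "instance_matrix X"
    "instance_constraints X" .
  have feasible
    using instance_facts(1,2,4)[OF cm, folded X_def]
    unfolding feasible_def constrained_def by auto
  from feasible_tree(1)[OF cm nc X_def this]
  show "\<exists>T :: nat phylogeny. persistent_perfect_phylogeny M T" by blast
qed

end
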